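(* Let $k$ be a field, let $R$ be a $k$-algebra, let $p\in R$ be an element such that $1\in pR+Rp$ but $1\notin pR$ and $1\notin Rp$, and choose $s,t\in R$ such that $1=ps+tp$. Let $B=B_{++}\cup B_{+-}\cup B_{-+}\cup B_{--}$, where $B_{++}$ is any $k$-basis of $pR\cap Rp$ containing $p$; $B_{+-}$ is any $k$-basis of $pR$ relative to $pR\cap Rp$ containing $ps$; $B_{-+}$ is any $k$-basis of $Rp$ relative to $pR\cap Rp$ containing $tp$; and $B_{--}$ is any $k$-basis of $R$ relative to $pR+Rp$. Let $$R'=R\langle q\mid pqp=p\rangle .$$ Then $R'$ has a $k$-basis given by all words in the generating set $B\cup\{q\}$ that contain no subwords of any of the following forms: (i) $xy$ with $x,y\in B$; (ii) the letter $(ps)$; (iii) $(xp)\,q^n\,(py)$ with $xp\in B_{++}\cup B_{-+}$, $py\in B_{++}\cup B_{+-}$, and $n\geq 1$; (iv) $(xp)\,q^n\,(tp)$ with $xp\in B_{++}\cup B_{-+}$ and $n\geq 1$. The reduction to this normal form may be accomplished by the following system of reductions: (1) $xy\mapsto (xy)_R$ for all $x,y\in B$; (2) $(ps)\mapsto 1-(tp)$; (3) for all $xp\in B_{++}\cup B_{-+}$, $py\in B_{++}\cup B_{+-}$: $(xp)\,q\,(py)\mapsto (xpy)_R$, and for every $n\geq 2$, $$(xp)\,q^n\,(py)\ \mapsto\ \sum_{v\in T((xp),n,(py))} v;$$ (4) for all $xp\in B_{++}\cup B_{-+}$: $(xp)\,q\,(tp)\mapsto (xp)\,q-(xps)_R$,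 and for every $n\geq 2$, $$(xp)\,q^n\,(tp)\ \mapsto\ (xp)\,q^n-\sum_{v\in T((xp),n,(ps))} v.$$
   Context: All rings are associative with unit. $R\langle q\mid pqp=p\rangle$ is the $k$-algebra obtained from $R$ by freely adjoining $q$ subject to $pqp=p$. If $U\subseteq V$ are $k$-vector spaces, a $k$-basis of $V$ relative to $U$ is a subset $B\subseteq V$ such that every element of $V$ can be written uniquely as the sum of an element of $U$ and a $k$-linear combination of elements of $B$. With the choices in the claim, $B$ is a $k$-basis of $R$, and so is $(B\cup\{1\})-\{ps\}$. Elements of $B$ are single letters. An element of $B_{++}\cup B_{-+}$ is written $(xp)$ with $x\in R$, and an element of $B_{++}\cup B_{+-}$ is written $(py)$ with $y\in R$; $x,y$ need not be unique, but products such as $xpy$, $xps$, $tpy$ in $R$ depend only on $xp$, $py$, $ps$, $tp$. For an expression $f$ representing an element of $R$, $f_R$ denotes the unique $k$-linear combination of elements of $(B\cup\{1\})-\{ps\}$ giving its value in $R$. Definition of $T((xp),n,(py))$ for $n\ge 2$, $(xp)\in B_{++}\cup B_{-+}$, $(py)\in B_{++}\cup B_{+-}$: it is the family, indexed by the nonempty subsets of the string of $n$ letters $q$ in the word $(xp)\,q^n\,(py)$ containing no two adjacent $q$'s (the $q$'s in the chosen subset are called marked), of the $k$-linear combinations of words in $B\cup\{q\}$ obtained as follows. If the first $q$ is marked, replace the initial $(xp)\,q$ by $(xps)_R$. If the last $q$ is marked, replace the final $q\,(py)$ by $(tpy)_R$. Replace every marked $q$ that is neither first nor last by $(tps)_R$.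 Finally multiply the result by $-1$ if the number of marked $q$'s is even. Sums over $T$ are over this indexed family. Words and reductions: if an algebra $S$ is generated by a set $G$, a word is a member of the free monoid on $G$ inside the free algebra $k\langle G\rangle$ (the empty word is $1$). A family of words gives a $k$-basis of $S$ if it maps one-to-one into $S$ with image a $k$-basis of $S$. A reduction $W\mapsto f$ permits replacing any word $uWv$ occurring in an element of $k\langle G\rangle$ by $ufv$. That reduction to a normal form may be accomplished by a system of reductions means that the corresponding relations $W=f$ hold in $S$, and that, starting from any element of $k\langle G\rangle$, repeated application of the reductions terminates at the unique $k$-linear combination of words of the given basis having the same image in $S$. *)

theory Defs
  imports "HOL-Algebra.Algebra" "HOL-Algebra.Algebraic_Closure_Type"
    "HOL-Library.Poly_Mapping" "HOL-Library.Sublist"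
begin

locale k_algebra = vector_space scale
  for scale :: "'k::field \<Rightarrow> 'r::ring_1 \<Rightarrow> 'r" +
  assumes scale_mult_left: "scale c (x * y) = scale c x * y"
    and scale_mult_right: "scale c (x * y) = x * scale c y"

definition right_ideal_of :: "'r::ring_1 \<Rightarrow> 'r set"
  where "right_ideal_of p = {p * a | a. True}"

definition left_ideal_of :: "'r::ring_1 \<Rightarrow> 'r set"
  where "left_ideal_of p = {a * p | a. True}"

definition ideal_sum_of :: "'r::ring_1 \<Rightarrow> 'r set"
  where "ideal_sum_of p = {a + b | a b. a \<in> right_ideal_of p \<and> b \<in> left_ideal_of p}"

definition lin_comb :: "('k::field \<Rightarrow> 'r::ring_1 \<Rightarrow> 'r) \<Rightarrow> ('r \<Rightarrow>\<^sub>0 'k) \<Rightarrow> 'r"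
  where "lin_comb scale c = (\<Sum>b\<in>Poly_Mapping.keys c. scale (Poly_Mapping.lookup c b) b)"

text \<open>\<open>rel_basis scale U V B\<close>: the set \<open>B\<close> is a basis of \<open>V\<close> relative to \<open>U\<close>.
  An ordinary basis of \<open>V\<close> is a basis relative to \<open>{0}\<close>.\<close>

definition rel_basis :: "('k::field \<Rightarrow> 'r::ring_1 \<Rightarrow> 'r) \<Rightarrow> 'r set \<Rightarrow> 'r set \<Rightarrow> 'r set \<Rightarrow> bool"
  where "rel_basis scale U V B \<longleftrightarrow> B \<subseteq> V \<and>
    (\<forall>v\<in>V. \<exists>!(u, c). u \<in> U \<and> Poly_Mapping.keys c \<subseteq> B \<and> v = u + lin_comb scale c)"


section \<open>Free algebras\<close>

text \<open>Words are lists, with concatenation as the (additively written) monoid operation.  The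
  convolution product of \<^theory>\<open>HOL-Library.Poly_Mapping\<close> then makes
  \<open>'g list \<Rightarrow>\<^sub>0 'k\<close> the free associative \<open>'k\<close>-algebra on \<open>'g\<close>; its unit is
  the empty word.\<close>

instantiation list :: (type) monoid_add
begin
definition zero_list :: "'a list" where "zero_list = []"
definition plus_list :: "'a list \<Rightarrow> 'a list \<Rightarrow> 'a list" where "plus_list = (@)"
instance by standard (simp_all add: zero_list_def plus_list_def)
end

type_synonym ('g, 'k) free_algebra = "'g list \<Rightarrow>\<^sub>0 'k"

definition word :: "'g list \<Rightarrow> ('g, 'k::field) free_algebra"
  where "word w = Poly_Mapping.single w 1"

abbreviation letter :: "'g \<Rightarrow> ('g, 'k::field) free_algebra"
  where "letter g \<equiv> word [g]"

definition fscale :: "'k::field \<Rightarrow> ('g, 'k) free_algebra \<Rightarrow> ('g, 'k) free_algebra"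
  where "fscale c f = Poly_Mapping.map ((*) c) f"

definition span_words :: "'g list set \<Rightarrow> ('g, 'k::field) free_algebra set"
  where "span_words W = {f. Poly_Mapping.keys f \<subseteq> W}"

text \<open>The quotient of the free algebra by the two-sided ideal generated by \<open>Rel\<close>, and the
  canonical map onto it.  The scalar action on cosets is \<open>c (f + I) = c f + I\<close>; the union
  below is over equal cosets.\<close>

definition rel_ideal :: "('g, 'k::field) free_algebra set \<Rightarrow> ('g, 'k) free_algebra set"
  where "rel_ideal Rel = genideal ring_of_type_algebra Rel"

definition quot_map ::
    "('g, 'k::field) free_algebra set \<Rightarrow> ('g, 'k) free_algebra \<Rightarrow> ('g, 'k) free_algebra set"
  where "quot_map Rel f = rel_ideal Rel +>\<^bsub>ring_of_type_algebra\<^esub> f"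

definition presented_algebra ::
    "('g, 'k::field) free_algebra set \<Rightarrow> ('k, ('g, 'k) free_algebra set) module"
  where "presented_algebra Rel =
    ring.extend (ring_of_type_algebra Quot rel_ideal Rel)
      (module.fields (\<lambda>c A. \<Union>f\<in>A. quot_map Rel (fscale c f)))"

definition module_basis :: "('k::field, 'm, 'e) module_scheme \<Rightarrow> 'm set \<Rightarrow> bool"
  where "module_basis M V \<longleftrightarrow> V \<subseteq> carrier M \<and>
    (\<forall>v\<in>carrier M. \<exists>!c. Poly_Mapping.keys c \<subseteq> V \<and>
       v = finsum M (\<lambda>x. Poly_Mapping.lookup c x \<odot>\<^bsub>M\<^esub> x) (Poly_Mapping.keys c))"

definition words_give_basis ::
    "('k::field, 'm, 'e) module_scheme \<Rightarrow> (('g, 'k) free_algebra \<Rightarrow> 'm) \<Rightarrow> 'g list set \<Rightarrow> bool"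
  where "words_give_basis S \<pi> W \<longleftrightarrow>
    inj_on (\<lambda>w. \<pi> (word w)) W \<and> module_basis S ((\<lambda>w. \<pi> (word w)) ` W)"


section \<open>Reductions\<close>

type_synonym ('g, 'k) reductions = "('g list \<times> ('g, 'k) free_algebra) set"

text \<open>One step replaces one word \<open>u @ W @ v\<close> occurring in \<open>a\<close>, together with its
  coefficient, by \<open>u f v\<close>.\<close>

definition reduction_step ::
    "('g, 'k::field) reductions \<Rightarrow> ('g, 'k) free_algebra \<Rightarrow> ('g, 'k) free_algebra \<Rightarrow> bool"
  where "reduction_step Rs a a' \<longleftrightarrow>
    (\<exists>W f u v. (W, f) \<in> Rs \<and> u @ W @ v \<in> Poly_Mapping.keys a \<and>
       a' = a + fscale (Poly_Mapping.lookup a (u @ W @ v))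
                  (word u * f * word v - word (u @ W @ v)))"

text \<open>\<open>reduces_to_normal_form \<pi> G W Rs\<close>: reduction to linear combinations of words in
  \<open>W\<close>, in the algebra that is the image under \<open>\<pi>\<close> of the free algebra on \<open>G\<close>, may be
  accomplished by \<open>Rs\<close>.  No sequence of reductions may go on forever, whatever the choices made,
  and an element admitting no further reduction must be the unique normal form.\<close>

definition reduces_to_normal_form ::
    "(('g, 'k::field) free_algebra \<Rightarrow> 'm) \<Rightarrow> 'g set \<Rightarrow> 'g list set \<Rightarrow> ('g, 'k) reductions \<Rightarrow> bool"
  where "reduces_to_normal_form \<pi> G W Rs \<longleftrightarrow>
    (\<forall>(w, f)\<in>Rs. \<pi> (word w) = \<pi> f) \<and>
    (\<forall>a\<in>span_words (lists G).
       (\<nexists>h. h 0 = a \<and> (\<forall>i::nat. reduction_step Rs (h i) (h (Suc i)))) \<and>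
       (\<exists>b. b \<in> span_words W \<and> \<pi> b = \<pi> a \<and>
          (\<forall>b'. b' \<in> span_words W \<and> \<pi> b' = \<pi> a \<longrightarrow> b' = b) \<and>
          (\<forall>d. (reduction_step Rs)\<^sup>*\<^sup>* a d \<and> (\<nexists>e. reduction_step Rs d e) \<longrightarrow> d = b)))"


section \<open>Adjoining a universal inner inverse\<close>

text \<open>\<open>R\<langle>q | pqp = p\<rangle>\<close> is presented by one letter for each element of \<open>R\<close> and the
  letter \<open>q\<close>, the relations being those that make \<open>R\<close> map in as a unital algebra, together
  with \<open>pqp = p\<close>.  Words in \<open>B \<union> {q}\<close> are words over the same letters.\<close>

datatype 'r gen = Elt 'r | Q

definition inner_inverse_rels ::
    "('k::field \<Rightarrow> 'r::ring_1 \<Rightarrow> 'r) \<Rightarrow> 'r \<Rightarrow> ('r gen, 'k) free_algebra set"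
  where "inner_inverse_rels scale p =
    {letter (Elt (x + y)) - (letter (Elt x) + letter (Elt y)) | x y. True} \<union>
    {letter (Elt (scale c x)) - fscale c (letter (Elt x)) | c x. True} \<union>
    {letter (Elt (x * y)) - letter (Elt x) * letter (Elt y) | x y. True} \<union>
    {letter (Elt 1) - 1} \<union>
    {letter (Elt p) * letter Q * letter (Elt p) - letter (Elt p)}"

text \<open>\<open>nf_R scale C r\<close> is \<open>r\<^sub>R\<close>, where \<open>C\<close> is a basis of \<open>R\<close> containing \<open>1\<close>;
  the basis element \<open>1\<close> is the empty word, not a letter.\<close>

definition nf_R ::
    "('k::field \<Rightarrow> 'r::ring_1 \<Rightarrow> 'r) \<Rightarrow> 'r set \<Rightarrow> 'r \<Rightarrow> ('r gen, 'k) free_algebra"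
  where "nf_R scale C r =
    (let c = (THE c. Poly_Mapping.keys c \<subseteq> C \<and> lin_comb scale c = r)
     in \<Sum>b\<in>Poly_Mapping.keys c.
          fscale (Poly_Mapping.lookup c b) (if b = 1 then 1 else letter (Elt b)))"

definition forbidden_words ::
    "'r::ring_1 \<Rightarrow> 'r \<Rightarrow> 'r \<Rightarrow> 'r set \<Rightarrow> 'r set \<Rightarrow> 'r set \<Rightarrow> 'r gen list set"
  where "forbidden_words p s t B Bxp Bpy =
    {[Elt x, Elt y] | x y. x \<in> B \<and> y \<in> B} \<union>
    {[Elt (p * s)]} \<union>
    {[Elt u] @ replicate n Q @ [Elt w] | u n w. u \<in> Bxp \<and> w \<in> Bpy \<and> n \<ge> 1} \<union>
    {[Elt u] @ replicate n Q @ [Elt (t * p)] | u n. u \<in> Bxp \<and> n \<ge> 1}"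

definition normal_words ::
    "'r::ring_1 \<Rightarrow> 'r \<Rightarrow> 'r \<Rightarrow> 'r set \<Rightarrow> 'r set \<Rightarrow> 'r set \<Rightarrow> 'r gen list set"
  where "normal_words p s t B Bxp Bpy =
    {w \<in> lists (Elt ` B \<union> {Q}). \<forall>f\<in>forbidden_words p s t B Bxp Bpy. \<not> sublist f w}"

text \<open>The family \<open>T((xp), n, (py))\<close>, for \<open>n \<ge> 2\<close>: its index set, with the \<open>n\<close> letters
  \<open>q\<close> numbered from \<open>0\<close>, and its member with index \<open>M\<close>.  The argument \<open>nf\<close> stands
  for \<open>r \<mapsto> r\<^sub>R\<close>.\<close>

definition T_index :: "nat \<Rightarrow> nat set set"
  where "T_index n = {M. M \<subseteq> {..<n} \<and> M \<noteq> {} \<and> (\<forall>i\<in>M. Suc i \<notin> M)}"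

definition T_member ::
    "('r::ring_1 \<Rightarrow> ('r gen, 'k::field) free_algebra) \<Rightarrow> 'r \<Rightarrow> 'r \<Rightarrow> 'r \<Rightarrow> 'r \<Rightarrow> nat \<Rightarrow> 'r \<Rightarrow> nat set
      \<Rightarrow> ('r gen, 'k) free_algebra"
  where "T_member nf p s t x n y M =
    (if even (card M) then - 1 else 1) *
    ((if 0 \<in> M then nf (x * p * s) else letter (Elt (x * p)) * letter Q) *
     (\<Prod>i\<leftarrow>[1..<n - 1]. if i \<in> M then nf (t * p * s) else letter Q) *
     (if n - 1 \<in> M then nf (t * p * y) else letter Q * letter (Elt (p * y))))"

definition T_sum ::
    "('r::ring_1 \<Rightarrow> ('r gen, 'k::field) free_algebra) \<Rightarrow> 'r \<Rightarrow> 'r \<Rightarrow> 'r \<Rightarrow> 'r \<Rightarrow> nat \<Rightarrow> 'r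
      \<Rightarrow> ('r gen, 'k) free_algebra"
  where "T_sum nf p s t x n y = (\<Sum>M\<in>T_index n. T_member nf p s t x n y M)"

text \<open>A letter of \<open>Bxp\<close> or \<open>Bpy\<close> may factor as \<open>x * p\<close> or \<open>p * y\<close> in several
  ways; the reductions range over all factorizations, which give the same right-hand sides.\<close>

definition inner_inverse_reductions ::
    "('r::ring_1 \<Rightarrow> ('r gen, 'k::field) free_algebra) \<Rightarrow> 'r \<Rightarrow> 'r \<Rightarrow> 'r
      \<Rightarrow> 'r set \<Rightarrow> 'r set \<Rightarrow> 'r set \<Rightarrow> ('r gen, 'k) reductions"
  where "inner_inverse_reductions nf p s t B Bxp Bpy =
    {([Elt x, Elt y], nf (x * y)) | x y. x \<in> B \<and> y \<in> B} \<union>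
    {([Elt (p * s)], 1 - letter (Elt (t * p)))} \<union>
    {([Elt (x * p), Q, Elt (p * y)], nf (x * p * y)) | x y. x * p \<in> Bxp \<and> p * y \<in> Bpy} \<union>
    {([Elt (x * p)] @ replicate n Q @ [Elt (p * y)], T_sum nf p s t x n y) | x n y.
       x * p \<in> Bxp \<and> p * y \<in> Bpy \<and> n \<ge> 2} \<union>
    {([Elt (x * p), Q, Elt (t * p)], word [Elt (x * p), Q] - nf (x * p * s)) | x.
       x * p \<in> Bxp} \<union>
    {([Elt (x * p)] @ replicate n Q @ [Elt (t * p)],
       word ([Elt (x * p)] @ replicate n Q) - T_sum nf p s t x n s) | x n.
       x * p \<in> Bxp \<and> n \<ge> 2}"

end

theory Submission
  imports Defs "HOL-Library.Multiset"
begin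

text \<open>Every reduction decreases, lexicographically, the number of letters \<open>q\<close>, the length and the
  number of letters \<open>ps\<close> of a word, so reduction terminates, and it ends at a combination of normal
  words.  It remains to see that the normal words are linearly independent in \<open>R'\<close>.  Instead of
  resolving ambiguities, let \<open>V\<close> be the vector space on the normal words and make it a right
  \<open>R'\<close>-module: \<open>q\<close> appends a letter, and \<open>R\<close> acts by recursion on the number of letters \<open>q\<close>.  After
  a word ending in \<open>(xp)q\<^sup>n\<close>, one writes an element of \<open>R\<close> as \<open>py + d\<close>, with \<open>d\<close> a combination of
  \<open>1\<close> and of letters that may follow, and absorbs \<open>py\<close>: \<open>v(xp)q \<cdot> py = v \<cdot> xpy\<close>, and for a word
  \<open>w = \<dots>(xp)q\<^sup>n\<close> with \<open>n \<ge> 1\<close>, \<open>wq \<cdot> py = w \<cdot> tpy + (w \<cdot> ps)q \<cdot> py\<close>, where \<open>w \<cdot> ps\<close> has fewer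
  letters \<open>q\<close> than \<open>w\<close>.  The module axioms and \<open>pqp = p\<close> follow by the same induction, and a
  normal word sends the empty word to itself.\<close>


section \<open>The free algebra as a vector space\<close>

text \<open>Why two bases: after a word ending in \<open>(xp) q^n\<close> with n >= 1 all of
  \<open>pR\<close> is absorbed, and 1 - tp = ps lies in \<open>pR\<close>, so there the letter tp
  differs from 1 only by an absorbed element. Hence tp is dropped from the basis (\<open>E\<close>),
  while elsewhere ps is dropped (\<open>C\<close>). The obstacle is that \<open>(w ps) q py\<close>
  feeds the output of the recursion back into it. It is well-founded because ps is itself absorbed
  by \<open>w\<close>: this costs at least one q, which pays for the q appended afterwards. The drop
  in degree and the absorption formula depend on each other and are proved together. Origin of T: in
  \<open>R'\<close> let U_k = xp q (tp q)^k. From tp = 1 - ps one gets U_{k+1} = U_k q - (U_k ps) q,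
  where U_0 ps = xps and U_{k+1} ps = U_k tps. Unfolding writes U_k as a signed sum over sets of
  marked letters q. A factor tps or xps is always followed by a plain q, so no two adjacent letters
  are marked. The reduction of \<open>(xp) q^(k+2) (py)\<close> is the identity U_k (1 - ps) q py =
  U_k tpy, solved for the term without marks.\<close>

lemma fscale_conv_mult: "fscale c f = Poly_Mapping.single 0 c * f"
  unfolding fscale_def by (rule mult_map_scale_conv_mult)

lemma lookup_fscale [simp]: "Poly_Mapping.lookup (fscale c f) w = c * Poly_Mapping.lookup f w"
  unfolding fscale_def by (simp add: Poly_Mapping.map.rep_eq when_def)

lemma vector_space_fscale: "vector_space fscale"
  by unfold_locales (auto intro!: poly_mapping_eqI simp: lookup_add algebra_simps)

interpretation fa: vector_space fscale
  by (rule vector_space_fscale)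

lemma word_Nil: "word [] = 1"
  by (simp add: word_def flip: zero_list_def)

lemma word_append: "word (u @ v) = word u * word v"
  by (simp add: word_def mult_single flip: plus_list_def)

lemma keys_word [simp]: "Poly_Mapping.keys (word w :: ('g, 'k::field) free_algebra) = {w}"
  by (simp add: word_def)

lemma lookup_word: "Poly_Mapping.lookup (word w) v = (if v = w then 1 else 0)"
  by (simp add: word_def lookup_single when_def)

lemma fscale_word: "fscale c (word w) = Poly_Mapping.single w c"
  by (rule poly_mapping_eqI) (simp add: lookup_word lookup_single when_def)

lemma free_algebra_expand:
  "f = (\<Sum>w\<in>Poly_Mapping.keys f. fscale (Poly_Mapping.lookup f w) (word w))"
  by (rule poly_mapping_eqI)
     (auto simp: lookup_sum lookup_word sum.delta' in_keys_iff if_distrib cong: if_cong)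

text \<open>Scalars sit on the empty word; they are central because the empty word is neutral on
  both sides and the field is commutative. This gives compatibility of \<open>fscale\<close> with
  both factors of a product.\<close>

lemma single_0_commute: "Poly_Mapping.single 0 c * f = f * Poly_Mapping.single (0::'g list) (c::'k::field)"
proof -
  let ?K = "Poly_Mapping.keys f"
  have f: "f = (\<Sum>w\<in>?K. Poly_Mapping.single w (Poly_Mapping.lookup f w))"
    using free_algebra_expand[of f] by (simp add: fscale_word)
  have "Poly_Mapping.single 0 c * (\<Sum>w\<in>?K. Poly_Mapping.single w (Poly_Mapping.lookup f w)) =
      (\<Sum>w\<in>?K. Poly_Mapping.single w (Poly_Mapping.lookup f w)) * Poly_Mapping.single 0 c"
    unfolding sum_distrib_left sum_distrib_right mult_single by (simp add: mult.commute)
  then show ?thesis unfolding f[symmetric] .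
qed

lemma fscale_mult_left: "fscale c (f * g) = fscale c f * g"
  by (simp add: fscale_conv_mult mult.assoc)

lemma fscale_mult_right: "fscale c (f * g) = f * fscale c g"
  by (simp add: fscale_conv_mult single_0_commute[of c] mult.assoc)

lemma keys_fscale: "Poly_Mapping.keys (fscale c f) \<subseteq> Poly_Mapping.keys f"
  by (auto simp: in_keys_iff)

lemma subspace_span_words: "fa.subspace (span_words W)"
  unfolding span_words_def
  by (rule fa.subspaceI) (auto dest!: subsetD[OF Poly_Mapping.keys_add] subsetD[OF keys_fscale])

lemma span_words_add: "f \<in> span_words W \<Longrightarrow> g \<in> span_words W \<Longrightarrow> f + g \<in> span_words W"
  using subspace_span_words fa.subspace_add by blast

lemma span_words_scale: "f \<in> span_words W \<Longrightarrow> fscale c f \<in> span_words W"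
  using subspace_span_words fa.subspace_scale by blast

lemma span_words_diff: "f \<in> span_words W \<Longrightarrow> g \<in> span_words W \<Longrightarrow> f - g \<in> span_words W"
  using subspace_span_words fa.subspace_diff by blast

lemma span_words_uminus: "f \<in> span_words W \<Longrightarrow> - f \<in> span_words W"
  using subspace_span_words fa.subspace_neg by blast

lemma span_words_sum: "(\<And>i. i \<in> I \<Longrightarrow> f i \<in> span_words W) \<Longrightarrow> sum f I \<in> span_words W"
  using subspace_span_words fa.subspace_sum by blast

lemma span_words_word [simp]: "word w \<in> span_words W \<longleftrightarrow> w \<in> W"
  by (simp add: span_words_def)

lemma span_words_0 [simp]: "0 \<in> span_words W"
  by (simp add: span_words_def)

lemma span_words_mono: "f \<in> span_words V \<Longrightarrow> V \<subseteq> W \<Longrightarrow> f \<in> span_words W"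
  by (auto simp: span_words_def)

lemma span_words_mult:
  assumes "f \<in> span_words U" "g \<in> span_words V" "\<And>u v. u \<in> U \<Longrightarrow> v \<in> V \<Longrightarrow> u @ v \<in> W"
  shows "f * g \<in> span_words W"
  using Poly_Mapping.keys_mult[of f g] assms unfolding span_words_def plus_list_def by fast

section \<open>Linear extension of maps defined on words\<close>

definition lift :: "('a list \<Rightarrow> ('g, 'k) free_algebra) \<Rightarrow> ('a, 'k::field) free_algebra \<Rightarrow> ('g, 'k) free_algebra"
  where "lift f v = (\<Sum>w\<in>Poly_Mapping.keys v. fscale (Poly_Mapping.lookup v w) (f w))"

lemma lift_eq_sum:
  assumes "finite S" "Poly_Mapping.keys v \<subseteq> S"
  shows "lift f v = (\<Sum>w\<in>S. fscale (Poly_Mapping.lookup v w) (f w))"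
  unfolding lift_def using assms
  by (intro sum.mono_neutral_left) (auto simp: in_keys_iff)

lemma lift_word [simp]: "lift f (word w) = f w"
  by (simp add: lift_def lookup_word)

lemma lift_add: "lift f (v + v') = lift f v + lift f v'"
proof -
  let ?S = "Poly_Mapping.keys v \<union> Poly_Mapping.keys v'"
  have "lift f (v + v') = (\<Sum>w\<in>?S. fscale (Poly_Mapping.lookup (v + v') w) (f w))"
    by (intro lift_eq_sum finite_UnI finite_keys Poly_Mapping.keys_add)
  also have "\<dots> = (\<Sum>w\<in>?S. fscale (Poly_Mapping.lookup v w) (f w)) + (\<Sum>w\<in>?S. fscale (Poly_Mapping.lookup v' w) (f w))"
    by (simp add: lookup_add fa.scale_left_distrib sum.distrib)
  also have "\<dots> = lift f v + lift f v'"
    by (simp add: lift_eq_sum[of ?S v] lift_eq_sum[of ?S v'])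
  finally show ?thesis .
qed

lemma lift_scale: "lift f (fscale c v) = fscale c (lift f v)"
proof -
  have "lift f (fscale c v) = (\<Sum>w\<in>Poly_Mapping.keys v. fscale (Poly_Mapping.lookup (fscale c v) w) (f w))"
    by (intro lift_eq_sum) (auto simp: keys_fscale)
  then show ?thesis
    by (simp add: lift_def fa.scale_sum_right)
qed

lemma linear_lift: "Vector_Spaces.linear fscale fscale (lift f)"
  by (intro Vector_Spaces.linear.intro module_hom.intro vector_space_fscale
      module_hom_axioms.intro lift_add lift_scale fa.module_axioms)

lemma lift_diff: "lift f (v - v') = lift f v - lift f v'"
  using linear_lift unfolding Vector_Spaces.linear_def by (blast intro: module_hom.diff)

lemma lift_0 [simp]: "lift f 0 = 0"
  by (simp add: lift_def)

lemma lift_sum: "lift f (sum g I) = (\<Sum>i\<in>I. lift f (g i))"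
  using linear_lift unfolding Vector_Spaces.linear_def by (blast intro: module_hom.sum)

lemma lift_cong: "v \<in> span_words W \<Longrightarrow> (\<And>w. w \<in> W \<Longrightarrow> f w = g w) \<Longrightarrow> lift f v = lift g v"
  unfolding lift_def span_words_def by (intro sum.cong) auto

text \<open>Together with \<open>lift_cong\<close> this reduces identities between composed
  operators on the module to single normal words.\<close>

lemma lift_lift: "lift g (lift f v) = lift (\<lambda>w. lift g (f w)) v"
  by (simp add: lift_def[of f] lift_def[of "\<lambda>w. lift g (f w)"] lift_sum lift_scale)

lemma lift_fun_add: "lift (\<lambda>w. f w + g w) v = lift f v + lift g v"
  by (simp add: lift_def fa.scale_right_distrib sum.distrib)

lemma lift_fun_scale: "lift (\<lambda>w. fscale c (f w)) v = fscale c (lift f v)"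
  by (simp add: lift_def fa.scale_sum_right mult.commute)

lemma lift_in_span_words:
  "v \<in> span_words V \<Longrightarrow> (\<And>w. w \<in> V \<Longrightarrow> f w \<in> span_words W) \<Longrightarrow> lift f v \<in> span_words W"
  unfolding lift_def by (intro span_words_sum span_words_scale) (auto simp: span_words_def)

lemma lift_word_id: "lift word v = v"
  using free_algebra_expand[of v] by (simp add: lift_def)


section \<open>Relative bases\<close>

context k_algebra
begin

lemma lin_comb_eq_sum:
  assumes "finite S" "Poly_Mapping.keys c \<subseteq> S"
  shows "lin_comb scale c = (\<Sum>b\<in>S. scale (Poly_Mapping.lookup c b) b)"
  unfolding lin_comb_def using assms
  by (intro sum.mono_neutral_left) (auto simp: in_keys_iff)

lemma lin_comb_add: "lin_comb scale (c + d) = lin_comb scale c + lin_comb scale d"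
proof -
  let ?S = "Poly_Mapping.keys c \<union> Poly_Mapping.keys d"
  have "lin_comb scale (c + d) = (\<Sum>b\<in>?S. scale (Poly_Mapping.lookup (c + d) b) b)"
    by (intro lin_comb_eq_sum finite_UnI finite_keys Poly_Mapping.keys_add)
  also have "\<dots> = (\<Sum>b\<in>?S. scale (Poly_Mapping.lookup c b) b) + (\<Sum>b\<in>?S. scale (Poly_Mapping.lookup d b) b)"
    by (simp add: lookup_add scale_left_distrib sum.distrib)
  also have "\<dots> = lin_comb scale c + lin_comb scale d"
    by (simp add: lin_comb_eq_sum[of ?S c] lin_comb_eq_sum[of ?S d])
  finally show ?thesis .
qed

lemma lin_comb_uminus: "lin_comb scale (- c) = - lin_comb scale c"
  by (simp add: lin_comb_def sum_negf)

lemma lin_comb_diff: "lin_comb scale (c - d) = lin_comb scale c - lin_comb scale d"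
  using lin_comb_add[of c "- d"] by (simp add: lin_comb_uminus)

lemma lin_comb_single: "lin_comb scale (Poly_Mapping.single b a) = scale a b"
  by (simp add: lin_comb_def)

lemma lin_comb_0 [simp]: "lin_comb scale 0 = 0"
  by (simp add: lin_comb_def)

lemma span_eq_lin_comb: "span Y = {lin_comb scale c | c. Poly_Mapping.keys c \<subseteq> Y}"
proof (intro equalityI subsetI)
  fix x assume "x \<in> span Y"
  then show "x \<in> {lin_comb scale c | c. Poly_Mapping.keys c \<subseteq> Y}"
  proof (induction rule: span_induct_alt)
    case base
    show ?case by (rule CollectI, rule exI[of _ 0]) simp
  next
    case (step a x y)
    then obtain c where c: "y = lin_comb scale c" "Poly_Mapping.keys c \<subseteq> Y" by blast
    have "Poly_Mapping.keys (Poly_Mapping.single x a + c) \<subseteq> Y"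
      using Poly_Mapping.keys_add[of "Poly_Mapping.single x a" c] c step by (auto split: if_splits)
    then show ?case using c
      by (intro CollectI exI[of _ "Poly_Mapping.single x a + c"])
         (simp add: lin_comb_add lin_comb_single)
  qed
next
  fix x assume "x \<in> {lin_comb scale c | c. Poly_Mapping.keys c \<subseteq> Y}"
  then show "x \<in> span Y"
    unfolding lin_comb_def by (blast intro: span_sum span_scale span_base)
qed

lemma independent_iff_lin_comb:
  "independent Y \<longleftrightarrow> (\<forall>c. Poly_Mapping.keys c \<subseteq> Y \<longrightarrow> lin_comb scale c = 0 \<longrightarrow> c = 0)"
proof
  assume Y: "independent Y"
  show "\<forall>c. Poly_Mapping.keys c \<subseteq> Y \<longrightarrow> lin_comb scale c = 0 \<longrightarrow> c = 0"
  proof (intro allI impI)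
    fix c assume c: "Poly_Mapping.keys c \<subseteq> Y" "lin_comb scale c = 0"
    have "Poly_Mapping.lookup c b = 0" if "b \<in> Poly_Mapping.keys c" for b
      by (rule independentD[OF Y finite_keys[of c] c(1) _ that]) (use c in \<open>simp add: lin_comb_def\<close>)
    then show "c = 0" by (intro poly_mapping_eqI) (auto simp: in_keys_iff)
  qed
next
  assume *: "\<forall>c. Poly_Mapping.keys c \<subseteq> Y \<longrightarrow> lin_comb scale c = 0 \<longrightarrow> c = 0"
  show "independent Y"
    unfolding independent_explicit_module
  proof (intro allI impI)
    fix S u v
    assume S: "finite S" "S \<subseteq> Y" "(\<Sum>v\<in>S. scale (u v) v) = 0" "v \<in> S"
    define c where "c = (\<Sum>v\<in>S. Poly_Mapping.single v (u v))"
    have l: "Poly_Mapping.lookup c b = (if b \<in> S then u b else 0)" for b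
      using S(1) by (auto simp: c_def lookup_sum lookup_single when_def sum.delta)
    have k: "Poly_Mapping.keys c \<subseteq> S" by (auto simp: in_keys_iff l split: if_splits)
    then have "lin_comb scale c = 0"
      using S by (simp add: lin_comb_eq_sum[OF S(1)] l cong: sum.cong)
    then have "c = 0" using k S * by blast
    then show "u v = 0" using l[of v] S by simp
  qed
qed

text \<open>For a subspace \<open>U\<close>: the elements of \<open>Y\<close> have linearly
  independent images in the quotient by \<open>U\<close>. Phrased without forming the
  quotient.\<close>

definition independent_mod :: "'r set \<Rightarrow> 'r set \<Rightarrow> bool"
  where "independent_mod U Y \<longleftrightarrow>
    (\<forall>c. Poly_Mapping.keys c \<subseteq> Y \<longrightarrow> lin_comb scale c \<in> U \<longrightarrow> c = 0)"

lemma rel_basisD: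
  assumes "rel_basis scale U V Y" "subspace U" "U \<subseteq> V"
  shows "Y \<subseteq> V" "independent_mod U Y" "v \<in> V \<Longrightarrow> \<exists>u\<in>U. \<exists>x\<in>span Y. v = u + x"
proof -
  note r = assms(1)[unfolded rel_basis_def]
  show "Y \<subseteq> V" using r by blast
  show "independent_mod U Y"
    unfolding independent_mod_def
  proof (intro allI impI)
    fix c assume c: "Poly_Mapping.keys c \<subseteq> Y" "lin_comb scale c \<in> U"
    define Pr where "Pr = (\<lambda>(u, d). u \<in> U \<and> Poly_Mapping.keys d \<subseteq> Y \<and> lin_comb scale c = u + lin_comb scale d)"
    have "\<exists>!x. Pr x"
      using r c assms(3) unfolding Pr_def by blast
    \<comment> \<open>A combination that lies in \<open>U\<close> has two decompositions, one with
      all of it in the \<open>U\<close>-part and one with all of it in the \<open>Y\<close>-part;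
      uniqueness identifies them.\<close>
    moreover have "Pr (lin_comb scale c, 0)" "Pr (0, c)"
      using c subspace_0[OF assms(2)] by (auto simp: Pr_def)
    ultimately have "(lin_comb scale c, 0 :: 'r \<Rightarrow>\<^sub>0 'k) = (0, c)"
      by blast
    then show "c = 0" by simp
  qed
  assume "v \<in> V"
  then show "\<exists>u\<in>U. \<exists>x\<in>span Y. v = u + x"
    using r unfolding span_eq_lin_comb by blast
qed

lemma independent_Un_mod:
  assumes A: "independent A" and Y: "independent_mod (span A) Y"
  shows "independent (A \<union> Y)" "A \<inter> Y = {}"
proof -
  show disj: "A \<inter> Y = {}"
  proof (rule ccontr)
    assume "A \<inter> Y \<noteq> {}"
    then obtain b where b: "b \<in> A" "b \<in> Y" by blast
    then have "Poly_Mapping.single b 1 = (0 :: 'r \<Rightarrow>\<^sub>0 'k)"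
      using Y[unfolded independent_mod_def, rule_format, of "Poly_Mapping.single b 1"]
      by (auto simp: lin_comb_single intro: span_base)
    then show False by (metis lookup_single_eq lookup_zero zero_neq_one)
  qed
  show "independent (A \<union> Y)"
    unfolding independent_iff_lin_comb
  proof (intro allI impI)
    fix c assume c: "Poly_Mapping.keys c \<subseteq> A \<union> Y" "lin_comb scale c = 0"
    define cX where "cX = (\<Sum>b\<in>Poly_Mapping.keys c \<inter> Y. Poly_Mapping.single b (Poly_Mapping.lookup c b))"
    have lX: "Poly_Mapping.lookup cX b = (if b \<in> Y then Poly_Mapping.lookup c b else 0)" for b
      by (auto simp: cX_def lookup_sum lookup_single when_def sum.delta in_keys_iff)
    have kX: "Poly_Mapping.keys cX \<subseteq> Y" by (auto simp: in_keys_iff lX split: if_splits)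
    have kA: "Poly_Mapping.keys (c - cX) \<subseteq> A"
      using c(1) by (auto simp: in_keys_iff lX lookup_minus split: if_splits)
    have "lin_comb scale cX = - lin_comb scale (c - cX)"
      using c by (simp add: lin_comb_diff)
    moreover have "lin_comb scale (c - cX) \<in> span A"
      using kA unfolding span_eq_lin_comb by blast
    ultimately have "lin_comb scale cX \<in> span A" by (simp add: span_neg)
    then have "cX = 0" using Y kX unfolding independent_mod_def by blast
    then show "c = 0"
      using A kA c unfolding independent_iff_lin_comb by (simp add: lin_comb_diff)
  qed
qed

text \<open>Combinations of \<open>Y\<close> stay in \<open>V\<close>, so one that falls into
  \<open>U\<close> already falls into \<open>U \<inter> V\<close>; equivalently, \<open>V\<close>
  modulo \<open>U \<inter> V\<close> embeds into the quotient by \<open>U\<close>.\<close>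

lemma independent_mod_enlarge:
  assumes "independent_mod (U \<inter> V) Y" "Y \<subseteq> V" "subspace V"
  shows "independent_mod U Y"
  unfolding independent_mod_def
proof (intro allI impI)
  fix c assume c: "Poly_Mapping.keys c \<subseteq> Y" "lin_comb scale c \<in> U"
  then have "lin_comb scale c \<in> V"
    using span_minimal[OF assms(2,3)] unfolding span_eq_lin_comb by blast
  then show "c = 0" using c assms(1) unfolding independent_mod_def by blast
qed

lemma rel_basis_extend:
  assumes A: "independent A" "span A = U" and Y: "rel_basis scale U V Y" and V: "subspace V" "U \<subseteq> V"
  shows "independent (A \<union> Y)" "A \<inter> Y = {}" "span (A \<union> Y) = V"
proof -
  have U: "subspace U" using A subspace_span by blast
  note D = rel_basisD[OF Y U V(2)]
  show "independent (A \<union> Y)" "A \<inter> Y = {}"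
    using independent_Un_mod[OF A(1)] A(2) D(2) by auto
  have "span Y \<subseteq> V" using span_minimal[OF D(1) V(1)] .
  then show "span (A \<union> Y) = V"
    unfolding span_Un A(2) using D(3) V(2) subspace_add[OF V(1)] by blast
qed

text \<open>Steinitz exchange along \<open>1 = a + b\<close>: a span containing \<open>b\<close>
  contains \<open>1\<close> iff it contains \<open>a\<close>. Removing \<open>p * s\<close> yields
  \<open>C\<close>, removing \<open>t * p\<close> yields \<open>E\<close>.\<close>

lemma basis_exchange:
  assumes Y: "independent Y" "span Y = UNIV" and ab: "a \<in> Y" "b \<in> Y" "a \<noteq> b" "1 = a + b" and 1: "1 \<notin> Y"
  shows "independent (insert 1 (Y - {a}))" "span (insert 1 (Y - {a})) = UNIV"
proof -
  have "1 \<notin> span (Y - {a})"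
  proof
    assume "1 \<in> span (Y - {a})"
    moreover have "b \<in> span (Y - {a})" using ab by (auto intro: span_base)
    ultimately have "1 - b \<in> span (Y - {a})" by (rule span_diff)
    moreover have "1 - b = a" using ab by (simp add: algebra_simps)
    ultimately have "a \<in> span (Y - {a})" by simp
    then show False using Y ab dependent_def by blast
  qed
  then show "independent (insert 1 (Y - {a}))"
    using Y by (meson independent_insertI independent_mono Diff_subset)
  have "b \<in> span (insert 1 (Y - {a}))" using ab by (auto intro: span_base)
  moreover have "1 \<in> span (insert 1 (Y - {a}))" by (auto intro: span_base)
  ultimately have "1 - b \<in> span (insert 1 (Y - {a}))" by (rule span_diff[rotated])
  moreover have "1 - b = a" using ab by (simp add: algebra_simps)
  ultimately have "a \<in> span (insert 1 (Y - {a}))" by simp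
  then have "Y \<subseteq> span (insert 1 (Y - {a}))" by (auto intro: span_base)
  then show "span (insert 1 (Y - {a})) = UNIV"
    using Y(2) span_minimal[OF _ subspace_span, of Y] by blast
qed

end

section \<open>The bases\<close>

locale inner_inverse_bases = k_algebra scale
  for scale :: "'k::field \<Rightarrow> 'r::ring_1 \<Rightarrow> 'r" +
  fixes p s t :: 'r and Bpp Bpm Bmp Bmm :: "'r set"
  assumes one_notin_right: "1 \<notin> right_ideal_of p"
    and one_notin_left: "1 \<notin> left_ideal_of p"
    and one_eq: "1 = p * s + t * p"
    and Bpp: "rel_basis scale {0} (right_ideal_of p \<inter> left_ideal_of p) Bpp"
    and p_Bpp: "p \<in> Bpp"
    and Bpm: "rel_basis scale (right_ideal_of p \<inter> left_ideal_of p) (right_ideal_of p) Bpm"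
    and ps_Bpm: "p * s \<in> Bpm"
    and Bmp: "rel_basis scale (right_ideal_of p \<inter> left_ideal_of p) (left_ideal_of p) Bmp"
    and tp_Bmp: "t * p \<in> Bmp"
    and Bmm: "rel_basis scale (ideal_sum_of p) UNIV Bmm"
begin

abbreviation "pR \<equiv> right_ideal_of p"
abbreviation "Rp \<equiv> left_ideal_of p"
abbreviation "Bpy \<equiv> Bpp \<union> Bpm"
abbreviation "Bxp \<equiv> Bpp \<union> Bmp"
abbreviation "Bas \<equiv> Bpp \<union> Bpm \<union> Bmp \<union> Bmm"

text \<open>\<open>E\<close> contains a basis of \<open>pR\<close>; it takes the place of \<open>C\<close> after a word \<open>\<dots>(xp)q\<^sup>n\<close>.\<close>

abbreviation "C \<equiv> insert 1 (Bas - {p * s})"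
abbreviation "E \<equiv> insert 1 (Bas - {t * p})"

lemma subspace_pR: "subspace pR"
proof (rule subspaceI)
  show "0 \<in> pR" unfolding right_ideal_of_def by (rule CollectI, rule exI[of _ 0]) simp
  show "x + y \<in> pR" if "x \<in> pR" "y \<in> pR" for x y
    using that unfolding right_ideal_of_def by (auto simp flip: distrib_left)
  show "scale c x \<in> pR" if "x \<in> pR" for c x
    using that unfolding right_ideal_of_def by (auto simp: scale_mult_right)
qed

lemma subspace_Rp: "subspace Rp"
proof (rule subspaceI)
  show "0 \<in> Rp" unfolding left_ideal_of_def by (rule CollectI, rule exI[of _ 0]) simp
  show "x + y \<in> Rp" if "x \<in> Rp" "y \<in> Rp" for x y
    using that unfolding left_ideal_of_def by (auto simp flip: distrib_right)
  show "scale c x \<in> Rp" if "x \<in> Rp" for c x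
    using that unfolding left_ideal_of_def by (auto simp: scale_mult_left)
qed

lemma ideal_sum_eq: "ideal_sum_of p = {a + b | a b. a \<in> pR \<and> b \<in> Rp}"
  unfolding ideal_sum_of_def ..

lemma subspace_sum: "subspace (ideal_sum_of p)"
  unfolding ideal_sum_eq using subspace_sums[OF subspace_pR subspace_Rp] by simp

lemma right_idealI: "p * a \<in> pR" by (auto simp: right_ideal_of_def)
lemma left_idealI: "a * p \<in> Rp" by (auto simp: left_ideal_of_def)

lemma right_ideal_mult: "x \<in> pR \<Longrightarrow> x * a \<in> pR"
  by (auto simp: right_ideal_of_def mult.assoc)

lemma left_ideal_mult: "x \<in> Rp \<Longrightarrow> a * x \<in> Rp"
  by (auto simp: left_ideal_of_def) (metis mult.assoc)

lemma basis_pR_Int_Rp: "independent Bpp" "span Bpp = pR \<inter> Rp"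
  using rel_basis_extend[OF independent_empty _ Bpp subspace_inter[OF subspace_pR subspace_Rp]]
    subspace_0[OF subspace_pR] subspace_0[OF subspace_Rp] by auto

lemma basis_pR: "independent Bpy" "Bpp \<inter> Bpm = {}" "span Bpy = pR"
  using rel_basis_extend[OF basis_pR_Int_Rp Bpm subspace_pR] by auto

lemma basis_Rp: "independent Bxp" "Bpp \<inter> Bmp = {}" "span Bxp = Rp"
  using rel_basis_extend[OF basis_pR_Int_Rp Bmp subspace_Rp] by auto

lemma Bmp_mod: "Bmp \<subseteq> Rp" "independent_mod (pR \<inter> Rp) Bmp"
  using rel_basisD[OF Bmp subspace_inter[OF subspace_pR subspace_Rp]] by auto

text \<open>\<open>Bmp\<close> is given only as independent modulo \<open>pR \<inter> Rp\<close>. As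
  it lies in \<open>Rp\<close>, it is independent modulo \<open>pR\<close> as well, and so extends
  the basis \<open>Bpy\<close> of \<open>pR\<close>.\<close>

lemma Bpy_Bmp: "independent (Bpy \<union> Bmp)" "Bpy \<inter> Bmp = {}" "span (Bpy \<union> Bmp) = ideal_sum_of p"
proof -
  have "independent_mod pR Bmp"
    using independent_mod_enlarge[OF Bmp_mod(2,1) subspace_Rp] .
  then show "independent (Bpy \<union> Bmp)" "Bpy \<inter> Bmp = {}"
    using independent_Un_mod[OF basis_pR(1), of Bmp] basis_pR(3) by auto
  have "Bpy \<union> Bmp = Bpy \<union> Bxp" by blast
  then show "span (Bpy \<union> Bmp) = ideal_sum_of p"
    by (simp only: span_Un[of Bpy Bxp] basis_pR(3) basis_Rp(3) ideal_sum_eq)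
qed

lemma Bas_basis: "independent Bas" "(Bpy \<union> Bmp) \<inter> Bmm = {}" "span Bas = UNIV"
  using rel_basis_extend[OF Bpy_Bmp(1,3) Bmm subspace_UNIV] by auto

lemma one_in_sum: "1 \<in> ideal_sum_of p"
  unfolding ideal_sum_eq using one_eq right_idealI left_idealI by blast

text \<open>\<open>1\<close> is in the sum of the two ideals, hence not in the relative basis
  \<open>Bmm\<close>, and in neither ideal, hence not in the other three sets. Therefore
  \<open>1\<close> can stand for the empty word in \<open>put\<close> and \<open>nf_R\<close>
  without clashing with a letter.\<close>

lemma one_notin_Bas: "1 \<notin> Bas"
proof -
  have "Bpy \<subseteq> pR" "Bxp \<subseteq> Rp"
    using basis_pR(3) basis_Rp(3) span_superset by blast+
  moreover have "1 \<notin> Bmm"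
  proof
    assume "1 \<in> Bmm"
    then have "Poly_Mapping.single 1 1 = (0 :: 'r \<Rightarrow>\<^sub>0 'k)"
      using rel_basisD(2)[OF Bmm subspace_sum, unfolded independent_mod_def, rule_format,
          of "Poly_Mapping.single 1 1"] one_in_sum
      by (auto simp: lin_comb_single)
    then show False by (metis lookup_single_eq lookup_zero zero_neq_one)
  qed
  ultimately show ?thesis using one_notin_right one_notin_left by blast
qed

lemma ps_notin: "p * s \<notin> Bxp" "p * s \<notin> Bmm" and tp_notin: "t * p \<notin> Bpy" "t * p \<notin> Bmm"
  using ps_Bpm tp_Bmp Bas_basis(2) basis_pR(2) Bpy_Bmp(2) by blast+

lemma ps_neq_tp: "p * s \<noteq> t * p"
  using ps_Bpm tp_notin by auto

lemma C_basis: "independent C" "span C = UNIV"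
  using basis_exchange[OF Bas_basis(1,3), of "p * s" "t * p"] one_eq one_notin_Bas ps_Bpm tp_Bmp ps_neq_tp
  by auto

lemma E_basis: "independent E" "span E = UNIV"
  using basis_exchange[OF Bas_basis(1,3), of "t * p" "p * s"] one_eq one_notin_Bas ps_Bpm tp_Bmp ps_neq_tp
  by (auto simp: add.commute)


section \<open>A right module with basis the normal words\<close>

text \<open>Words are stored here in reversed order, the last letter first, since the module is a right
  module.\<close>

fun bound :: "'r gen list \<Rightarrow> bool" where
  "bound [] = False"
| "bound (Elt b # w) = False"
| "bound (Q # w) = (bound w \<or> (\<exists>u\<in>Bxp. \<exists>g. w = Elt u # g))"

text \<open>Every forbidden word ends in a letter of \<open>B\<close>, so normality can be tested
  when such a letter is appended. The flag \<open>bound\<close> records that the word so far ends,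
  in reading order, in \<open>(xp) q^n\<close> with n >= 1; it replaces the search through a run of
  q of arbitrary length.\<close>

fun rnormal :: "'r gen list \<Rightarrow> bool" where
  "rnormal [] = True"
| "rnormal (Q # w) = rnormal w"
| "rnormal (Elt b # w) = (rnormal w \<and> b \<in> Bas - {p * s} \<and> (\<forall>c g. w \<noteq> Elt c # g) \<and>
     (bound w \<longrightarrow> b \<notin> Bpy \<and> b \<noteq> t * p))"

abbreviation deg :: "'r gen list \<Rightarrow> nat"
  where "deg w \<equiv> count_list w Q"

definition put :: "'r gen list \<Rightarrow> 'r \<Rightarrow> ('r gen, 'k) free_algebra"
  where "put h b = (if b = 1 then word h else word (Elt b # h))"

text \<open>The choice is harmless: it is only multiplied by elements \<open>p * y\<close>, and
  \<open>left_factor u * (p * y) = u * y\<close> for \<open>u\<close> in \<open>Bxp\<close>.\<close>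

definition left_factor :: "'r \<Rightarrow> 'r"
  where "left_factor u = (SOME x. u = x * p)"

sublocale pr: vector_space_pair scale "fscale :: 'k \<Rightarrow> ('r gen, 'k) free_algebra \<Rightarrow> _"
  by (intro vector_space_pair.intro vector_space_axioms vector_space_fscale)

lemma bound_tl: "bound h \<Longrightarrow> deg (tl h) < deg h"
  by (cases h rule: bound.cases) auto

text \<open>The action of \<open>R\<close> on a word that is empty or ends in \<open>q\<close>.  If \<open>(xp)q\<close> meets \<open>py\<close>, the
  result is that of \<open>xpy\<close>; if \<open>h'qq\<close> meets \<open>py\<close>, with \<open>h'q\<close> bound, then \<open>1 = ps + tp\<close> is
  inserted between the two letters \<open>q\<close>.  The test on degrees only serves to make the recursion
  well-founded: it always succeeds.\<close>

function hact :: "'r gen list \<Rightarrow> 'r \<Rightarrow> ('r gen, 'k) free_algebra" where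
  "hact h r =
    (if bound h then
       pr.construct E (\<lambda>b. if b \<in> Bpy then
           (if \<exists>u g. tl h = Elt u # g
            then hact (tl (tl h)) ((case hd (tl h) of Elt u \<Rightarrow> left_factor u | Q \<Rightarrow> 0) * b)
            else hact (tl h) (t * b) +
              (\<Sum>w\<in>Poly_Mapping.keys (hact (tl h) (p * s)).
                 if deg w < deg (tl h)
                 then fscale (Poly_Mapping.lookup (hact (tl h) (p * s)) w) (hact (Q # w) b)
                 else 0))
         else put h b) r
     else pr.construct C (put h) r)"
  by pat_completeness auto
termination
\<comment> \<open>For the nested call on \<open>Q # w\<close> the degree test gives
  \<open>deg w + 1 \<le> deg (tl h)\<close>, and \<open>bound_tl\<close> gives
  \<open>deg (tl h) < deg h\<close>.\<close>
proof (relation "measure (\<lambda>(h, r). deg h)", goal_cases)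
  case (2 h r b)
  then show ?case using bound_tl[of h] by (cases "tl h") auto
qed (use bound_tl in fastforce)+


declare hact.simps [simp del]

definition Hq :: "('r gen, 'k) free_algebra \<Rightarrow> 'r \<Rightarrow> ('r gen, 'k) free_algebra"
  where "Hq v r = lift (\<lambda>w. hact (Q # w) r) v"

text \<open>The absorption formula of \<open>hact\<close> with its degree test removed. It is linear
  on all of \<open>R\<close>, but is used to describe \<open>hact h\<close> only on
  \<open>pR\<close> and for bound \<open>h\<close>.\<close>

definition corr :: "'r gen list \<Rightarrow> 'r \<Rightarrow> ('r gen, 'k) free_algebra"
  where "corr h b =
    (case tl h of Elt u # g \<Rightarrow> hact g (left_factor u * b)
     | h' \<Rightarrow> hact h' (t * b) + Hq (hact h' (p * s)) b)"

definition normal_le :: "nat \<Rightarrow> 'r gen list set"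
  where "normal_le n = {w. rnormal w \<and> deg w \<le> n}"

definition normal_less :: "nat \<Rightarrow> 'r gen list set"
  where "normal_less n = {w. rnormal w \<and> deg w < n}"

definition head :: "'r gen list \<Rightarrow> bool"
  where "head h \<longleftrightarrow> rnormal h \<and> (\<forall>c g. h \<noteq> Elt c # g)"

lemma head_Q [simp]: "head (Q # w) \<longleftrightarrow> rnormal w"
  by (simp add: head_def)

lemma headD: "rnormal (Elt b # g) \<Longrightarrow> head g"
  by (auto simp: head_def)

lemma left_factor: "u \<in> Bxp \<Longrightarrow> left_factor u * p = u"
proof -
  assume "u \<in> Bxp"
  then have "u \<in> Rp" using basis_Rp(3) span_superset by blast
  then have "\<exists>x. u = x * p" by (auto simp: left_ideal_of_def)
  then show ?thesis unfolding left_factor_def by (metis (mono_tags, lifting) someI)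
qed

lemma linear_in_subspace:
  assumes "Vector_Spaces.linear scale fscale f" "fa.subspace S" "\<And>b. b \<in> Y \<Longrightarrow> f b \<in> S" "x \<in> span Y"
  shows "f x \<in> S"
proof -
  interpret f: Vector_Spaces.linear scale fscale f by fact
  show ?thesis using assms(4)
    by (induction rule: span_induct_alt)
      (auto simp: f.zero f.add f.scale fa.subspace_0[OF assms(2)]
        intro!: fa.subspace_add[OF assms(2)] fa.subspace_scale[OF assms(2)] assms(3))
qed

lemma linear_hact: "Vector_Spaces.linear scale fscale (hact h)"
proof -
  obtain Y f where "independent Y" "\<And>r. hact h r = pr.construct Y f r"
    using C_basis(1) E_basis(1) hact.simps[of h] by (cases "bound h") auto
  then show ?thesis using pr.linear_construct[of Y f] by (metis ext)
qed

lemma hact_add: "hact h (x + y) = hact h x + hact h y"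
  and hact_scale: "hact h (scale c x) = fscale c (hact h x)"
  and hact_diff: "hact h (x - y) = hact h x - hact h y"
  using linear_hact[of h] unfolding Vector_Spaces.linear_def
  by (auto simp: module_hom.add module_hom.scale module_hom.diff)

lemma Hq_add: "Hq v (x + y) = Hq v x + Hq v y"
  by (simp add: Hq_def hact_add lift_fun_add)

lemma Hq_scale: "Hq v (scale c x) = fscale c (Hq v x)"
  by (simp add: Hq_def hact_scale lift_fun_scale)

lemma linearI:
  "(\<And>x y. f (x + y) = f x + f y) \<Longrightarrow> (\<And>c x. f (scale c x) = fscale c (f x)) \<Longrightarrow>
    Vector_Spaces.linear scale fscale f"
  by (intro Vector_Spaces.linear.intro module_hom.intro vector_space_fscale vector_space_axioms
      module_hom_axioms.intro fa.module_axioms module_axioms)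

lemma linear_corr: "Vector_Spaces.linear scale fscale (corr h)"
  by (rule linearI)
     (auto simp: corr_def distrib_left hact_add Hq_add hact_scale Hq_scale fa.scale_right_distrib
        algebra_simps simp flip: scale_mult_right split: list.split gen.split)

lemma hact_free: "\<not> bound h \<Longrightarrow> b \<in> C \<Longrightarrow> hact h b = put h b"
  by (simp add: hact.simps pr.construct_basis[OF C_basis(1)])

lemma hact_bound: "bound h \<Longrightarrow> b \<in> E - Bpy \<Longrightarrow> hact h b = put h b"
proof -
  assume a: "bound h" "b \<in> E - Bpy"
  then have "b \<in> E" by blast
  then show ?thesis using a by (subst hact.simps) (simp add: pr.construct_basis[OF E_basis(1)])
qed

lemma boundE:
  assumes "bound h"
  obtains h' where "h = Q # h'" "h' \<noteq> []"
  using assms by (cases h rule: bound.cases) fastforce+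

text \<open>The third hypothesis makes the degree test in \<open>hact\<close> succeed for every word
  of the sum, which thereby becomes \<open>Hq\<close>. The induction in
  \<open>hact_range_aux\<close> supplies it.\<close>

lemma hact_Bpy_aux:
  assumes "bound h" "b \<in> Bpy" "\<And>g. tl h = Q # g \<Longrightarrow> hact (tl h) (p * s) \<in> span_words (normal_less (deg (tl h)))"
  shows "hact h b = corr h b"
proof -
  have "b \<in> E" using assms(2) tp_notin by auto
  obtain h' where h: "h = Q # h'" "h' \<noteq> []" using assms(1) by (rule boundE)
  have eq: "hact h b =
    (if \<exists>u g. tl h = Elt u # g
     then hact (tl (tl h)) ((case hd (tl h) of Elt u \<Rightarrow> left_factor u | Q \<Rightarrow> 0) * b)
     else hact (tl h) (t * b) +
       (\<Sum>w\<in>Poly_Mapping.keys (hact (tl h) (p * s)).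
          if deg w < deg (tl h)
          then fscale (Poly_Mapping.lookup (hact (tl h) (p * s)) w) (hact (Q # w) b)
          else 0))"
    by (subst hact.simps) (simp only: assms(1,2) if_True pr.construct_basis[OF E_basis(1) \<open>b \<in> E\<close>])
  show ?thesis
  proof (cases "\<exists>u g. h' = Elt u # g")
    case True
    then show ?thesis unfolding eq by (auto simp: corr_def h)
  next
    case False
    then obtain g where g: "h' = Q # g" using h(2) by (metis gen.exhaust list.exhaust)
    let ?f = "hact h' (p * s)"
    have "(\<Sum>w\<in>Poly_Mapping.keys ?f. if deg w < deg h'
       then fscale (Poly_Mapping.lookup ?f w) (hact (Q # w) b) else 0) = Hq ?f b"
      unfolding Hq_def lift_def
      by (rule sum.cong) (use assms(3) h g in \<open>auto simp: span_words_def normal_less_def subset_iff\<close>)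
    then have "hact h b = hact h' (t * b) + Hq ?f b"
      using eq False by (simp only: h list.sel if_False)
    then show ?thesis by (simp add: corr_def h g)
  qed
qed

text \<open>The claims need each other. The formula \<open>corr\<close> at \<open>h\<close> requires
  the strict drop in degree at \<open>tl h\<close>, and the strict drop at \<open>h\<close> is read
  off from the formula.\<close>

lemma hact_range_aux:
  assumes "head h"
  shows "(\<forall>r. hact h r \<in> span_words (normal_le (deg h))) \<and>
    (bound h \<longrightarrow> (\<forall>z\<in>pR. hact h z = corr h z \<and> hact h z \<in> span_words (normal_less (deg h))))"
  using assms
proof (induction "deg h" arbitrary: h rule: less_induct)
  case less
  have IH1: "hact g r \<in> span_words (normal_le (deg g))" if "deg g < deg h" "head g" for g r
    using less.hyps that by blast
  have IH2: "hact g z \<in> span_words (normal_less (deg g))" if "deg g < deg h" "head g" "bound g" "z \<in> pR" for g z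
    using less.hyps that by blast
  \<comment> \<open>Outside \<open>Bpy\<close>, what is left of \<open>E\<close> is \<open>1\<close>
    and the letters that may follow a bound word: \<open>t * p\<close> is not in \<open>E\<close>,
    and \<open>p * s\<close> is in \<open>Bpy\<close>.\<close>
  have put: "put h b \<in> span_words (normal_le (deg h))"
    if "bound h \<Longrightarrow> b \<in> E - Bpy" "\<not> bound h \<Longrightarrow> b \<in> C" for b
    using that less.prems ps_Bpm one_notin_Bas
    by (auto simp: put_def normal_le_def head_def)
  have c: "hact h z = corr h z" if "bound h" "z \<in> pR" for z
  proof -
    have "hact h b = corr h b" if "b \<in> Bpy" for b
    proof (rule hact_Bpy_aux[OF \<open>bound h\<close> that])
      fix g assume "tl h = Q # g"
      then obtain h: "h = Q # Q # g" using boundE[OF \<open>bound h\<close>] by (metis list.sel(3))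
      show "hact (tl h) (p * s) \<in> span_words (normal_less (deg (tl h)))"
        using IH2[of "Q # g" "p * s"] less.prems \<open>bound h\<close> by (auto simp: h right_idealI)
    qed
    then show ?thesis
      using pr.linear_eq_on[OF linear_hact linear_corr, of z Bpy h h] basis_pR(3) that by auto
  qed
  have c_range: "corr h z \<in> span_words (normal_less (deg h))" if bh: "bound h" for z
  proof -
    obtain h' where h: "h = Q # h'" "h' \<noteq> []" using bh by (rule boundE)
    have mono: "f \<in> span_words (normal_less (deg h))" if "f \<in> span_words (normal_le (deg h'))" for f
      using that by (rule span_words_mono) (auto simp: h normal_le_def normal_less_def)
    show ?thesis
    proof (cases "\<exists>u g. h' = Elt u # g")
      case True
      then obtain u g where g: "h' = Elt u # g" by blast
      then have "head g" using less.prems h headD by auto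
      then have "hact g x \<in> span_words (normal_le (deg g))" for x
        using IH1[of g] h g by auto
      then show ?thesis using mono[of "hact g (left_factor u * z)"] by (simp add: corr_def h g)
    next
      case False
      then obtain g where g: "h' = Q # g" using h(2) by (metis gen.exhaust list.exhaust)
      have bh': "bound h'" "head h'" using bh less.prems by (auto simp: h g)
      have 1: "hact h' x \<in> span_words (normal_less (deg h))" for x
        using mono IH1[of h' x] bh' h by auto
      have 2: "hact h' (p * s) \<in> span_words (normal_less (deg h'))"
        using IH2[of h'] bh' h right_idealI by auto
      \<comment> \<open>The words of \<open>hact h' (p * s)\<close> have fewer than
        \<open>deg h'\<close> letters q, so after one more q there are still at most
        \<open>deg h'\<close>, which is less than \<open>deg h\<close>.\<close>
      have "Hq (hact h' (p * s)) z \<in> span_words (normal_less (deg h))"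
        unfolding Hq_def
      proof (rule lift_in_span_words[OF 2])
        fix w assume w: "w \<in> normal_less (deg h')"
        then have "hact (Q # w) z \<in> span_words (normal_le (deg (Q # w)))"
          using IH1[of "Q # w"] h by (auto simp: normal_less_def)
        then show "hact (Q # w) z \<in> span_words (normal_less (deg h))"
          by (rule span_words_mono) (use w in \<open>auto simp: normal_le_def normal_less_def h\<close>)
      qed
      then show ?thesis using 1 by (simp add: corr_def h g span_words_add)
    qed
  qed
  have "hact h r \<in> span_words (normal_le (deg h))" for r
  proof (cases "bound h")
    case True
    have "hact h b \<in> span_words (normal_le (deg h))" if "b \<in> E" for b
    proof (cases "b \<in> Bpy")
      case True
      then have "b \<in> pR" using basis_pR(3) span_superset by blast
      moreover have "normal_less (deg h) \<subseteq> normal_le (deg h)"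
        by (auto simp: normal_less_def normal_le_def)
      ultimately show ?thesis using c c_range[of b] \<open>bound h\<close> by (auto intro: span_words_mono)
    next
      case False
      then show ?thesis using put hact_bound \<open>bound h\<close> that by auto
    qed
    then show ?thesis
      using linear_in_subspace[OF linear_hact subspace_span_words, of E h] E_basis(2) by auto
  next
    case False
    have "hact h b \<in> span_words (normal_le (deg h))" if "b \<in> C" for b
      using put hact_free False that by auto
    then show ?thesis
      using linear_in_subspace[OF linear_hact subspace_span_words, of C h] C_basis(2) by auto
  qed
  then show ?case using c c_range by auto
qed

lemma hact_range:
  assumes "head h"
  shows "hact h r \<in> span_words (normal_le (deg h))"
    and "bound h \<Longrightarrow> z \<in> pR \<Longrightarrow> hact h z = corr h z"
    and "bound h \<Longrightarrow> z \<in> pR \<Longrightarrow> hact h z \<in> span_words (normal_less (deg h))"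
  using hact_range_aux[OF assms] by auto

lemma hact_rnormal: "head h \<Longrightarrow> hact h r \<in> span_words (Collect rnormal)"
  by (rule span_words_mono[OF hact_range(1)]) (auto simp: normal_le_def)

text \<open>A final letter is first merged with \<open>r\<close> inside \<open>R\<close>, so only
  words that are empty or end in q are handed to \<open>hact\<close>, and no two letters of
  \<open>B\<close> become adjacent.\<close>

definition wact :: "'r gen list \<Rightarrow> 'r \<Rightarrow> ('r gen, 'k) free_algebra"
  where "wact w r = (case w of Elt b # g \<Rightarrow> hact g (b * r) | _ \<Rightarrow> hact w r)"

definition act :: "('r gen, 'k) free_algebra \<Rightarrow> 'r \<Rightarrow> ('r gen, 'k) free_algebra"
  where "act v r = lift (\<lambda>w. wact w r) v"

definition qact :: "('r gen, 'k) free_algebra \<Rightarrow> ('r gen, 'k) free_algebra"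
  where "qact = lift (\<lambda>w. word (Q # w))"

lemma wact_simps: "wact (Elt b # g) r = hact g (b * r)" "head h \<Longrightarrow> wact h r = hact h r"
  by (auto simp: wact_def head_def split: list.split gen.split)

lemma wact_add: "wact w (x + y) = wact w x + wact w y"
  by (auto simp: wact_def hact_add distrib_left split: list.split gen.split)

lemma wact_scale: "wact w (scale c x) = fscale c (wact w x)"
  by (auto simp: wact_def hact_scale simp flip: scale_mult_right split: list.split gen.split)

lemma rnormal_cases:
  assumes "rnormal w"
  obtains "head w" | b g where "w = Elt b # g" "head g"
  using assms by (cases w rule: rnormal.cases) (auto simp: head_def)

lemma act_put: "head h \<Longrightarrow> act (put h b) r = hact h (b * r)"
  by (auto simp: put_def act_def wact_simps)

lemma hact_one: "head h \<Longrightarrow> hact h 1 = word h"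
  using hact_free[of h 1] hact_bound[of h 1] one_notin_Bas by (cases "bound h") (auto simp: put_def)

lemma hact_put: "rnormal (Elt b # g) \<Longrightarrow> hact g b = word (Elt b # g)"
  using hact_free[of g b] hact_bound[of g b] one_notin_Bas by (cases "bound g") (auto simp: put_def)

lemma bound_cases:
  assumes "bound h" "head h"
  obtains u g where "h = Q # Elt u # g" "u \<in> Bxp" "head g" "\<And>x. corr h x = hact g (left_factor u * x)"
  | h' where "h = Q # h'" "bound h'" "head h'" "\<And>x. corr h x = hact h' (t * x) + Hq (hact h' (p * s)) x"
proof -
  obtain h' where h: "h = Q # h'" "h' \<noteq> []" using assms(1) by (rule boundE)
  show ?thesis
  proof (cases "\<exists>u g. h' = Elt u # g")
    case True
    then show ?thesis using assms h that(1) by (auto simp: corr_def head_def)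
  next
    case False
    then obtain g where "h' = Q # g" using h(2) by (metis gen.exhaust list.exhaust)
    then show ?thesis using assms h that(2)[of h'] by (auto simp: corr_def)
  qed
qed

text \<open>Both sides are linear in \<open>r\<close>, so \<open>r\<close> may run through the basis
  that \<open>hact\<close> uses at \<open>h\<close>. A basis element that is merely appended
  recombines with \<open>r'\<close> by \<open>act_put\<close>. An absorbed one stays in
  \<open>pR\<close> after multiplication by \<open>r'\<close>, so \<open>corr\<close> expresses both
  sides through words of smaller degree.\<close>

lemma act_hact: "head h \<Longrightarrow> act (hact h r) r' = hact h (r * r')"
proof (induction "deg h" arbitrary: h r r' rule: less_induct)
  case less
  have lin1: "Vector_Spaces.linear scale fscale (\<lambda>r. act (hact h r) r')"
    by (rule linearI) (simp_all add: act_def hact_add hact_scale lift_add lift_scale)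
  have lin2: "Vector_Spaces.linear scale fscale (\<lambda>r. hact h (r * r'))"
    by (rule linearI) (simp_all add: hact_add hact_scale distrib_right flip: scale_mult_left)
  show ?case
  proof (cases "bound h")
    case False
    have "act (hact h b) r' = hact h (b * r')" if "b \<in> C" for b
      using that False less.prems by (simp add: hact_free act_put)
    then show ?thesis
      using pr.linear_eq_on[OF lin1 lin2, of r C] C_basis(2) by auto
  next
    case True
    have "act (hact h b) r' = hact h (b * r')" if "b \<in> E" for b
    proof (cases "b \<in> Bpy")
      case False
      then show ?thesis using that \<open>bound h\<close> less.prems by (simp add: hact_bound act_put)
    next
      case b: True
      then have "b \<in> pR" using basis_pR(3) span_superset by blast
      then have e: "hact h b = corr h b" "hact h (b * r') = corr h (b * r')"
        using hact_range(2)[OF less.prems] True right_ideal_mult by auto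
      from True less.prems show ?thesis
      proof (cases rule: bound_cases)
        case (1 u g)
        have "deg g < deg h" using 1(1) by simp
        from less.hyps[OF this 1(3)] show ?thesis by (simp only: e 1(4) mult.assoc)
      next
        case (2 h')
        let ?v = "hact h' (p * s)"
        have "?v \<in> span_words (normal_less (deg h'))"
          using hact_range(3)[of h'] 2 right_idealI by auto
        then have "lift (\<lambda>w. act (hact (Q # w) b) r') ?v = lift (\<lambda>w. hact (Q # w) (b * r')) ?v"
          using less.hyps 2 by (intro lift_cong) (auto simp: normal_less_def)
        then have "act (Hq ?v b) r' = Hq ?v (b * r')"
          by (simp add: act_def Hq_def lift_lift)
        moreover have "act (hact h' (t * b)) r' = hact h' (t * b * r')"
          using less.hyps[of h'] 2 by simp
        ultimately show ?thesis
          by (simp only: e 2(4) mult.assoc act_def lift_add)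
      qed
    qed
    then show ?thesis
      using pr.linear_eq_on[OF lin1 lin2, of r E] E_basis(2) by auto
  qed
qed

text \<open>\<open>Hq v r\<close> is \<open>v q r\<close>, so this is the relation \<open>pqp = p\<close>.\<close>

lemma Hq_hact: "head g \<Longrightarrow> z \<in> Rp \<Longrightarrow> Hq (hact g z) (p * y) = hact g (z * y)"
proof (induction "deg g" arbitrary: g z y rule: less_induct)
  case less
  have letter_case: "Hq (word (Elt b # g)) (p * y) = hact g (b * y)"
    if "b \<in> Bxp" "rnormal (Elt b # g)" for b y
  proof -
    have "bound (Q # Elt b # g)" "head (Q # Elt b # g)" using that by auto
    then have "hact (Q # Elt b # g) (p * y) = corr (Q # Elt b # g) (p * y)"
      using hact_range(2) right_idealI by blast
    also have "\<dots> = hact g (left_factor b * p * y)" by (simp add: corr_def mult.assoc)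
    finally show ?thesis by (simp add: Hq_def left_factor[OF that(1)])
  qed
  have lin1: "Vector_Spaces.linear scale fscale (\<lambda>z. Hq (hact g z) (p * y))"
    by (rule linearI) (simp_all add: Hq_def hact_add hact_scale lift_add lift_scale)
  have lin2: "Vector_Spaces.linear scale fscale (\<lambda>z. hact g (z * y))"
    by (rule linearI) (simp_all add: hact_add hact_scale distrib_right flip: scale_mult_left)
  have "Hq (hact g b) (p * y) = hact g (b * y)" if b: "b \<in> Bxp" for b
  proof (cases "bound g")
    case False
    then have "rnormal (Elt b # g)" using less.prems(1) b ps_notin by (auto simp: head_def)
    then show ?thesis using letter_case b by (simp add: hact_put)
  next
    case True
    have gc: "hact g z = corr g z" if "z \<in> pR" for z
      using hact_range(2) less.prems(1) True that by blast
    \<comment> \<open>At a bound \<open>g\<close>, the elements of \<open>Bpp\<close> are absorbed,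
      \<open>t * p\<close> turns into \<open>1 - p * s\<close>, and the remaining letters are
      appended.\<close>
    consider "b \<in> Bpp" | "b \<in> Bmp" "b \<noteq> t * p" | "b = t * p" using b by blast
    then show ?thesis
    proof cases
      case 2
      then have "rnormal (Elt b # g)" using less.prems(1) b ps_notin Bpy_Bmp(2) by (auto simp: head_def)
      then show ?thesis using letter_case b by (simp add: hact_put)
    next
      case 3
      \<comment> \<open>Here the defining recursion at \<open>Q # g\<close> is read backwards:
        moving its term \<open>Hq (hact g (p * s)) (p * y)\<close> to the other side leaves
        \<open>hact g (t * p * y)\<close>.\<close>
      have "b = 1 - p * s" using 3 one_eq by (simp add: algebra_simps)
      then have 1: "hact g b = word g - hact g (p * s)"
        by (simp add: hact_diff hact_one less.prems(1))
      have "bound (Q # g)" "head (Q # g)" using True less.prems by (auto simp: head_def)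
      then have "hact (Q # g) (p * y) = corr (Q # g) (p * y)"
        using hact_range(2) right_idealI by blast
      also have "\<dots> = hact g (t * p * y) + Hq (hact g (p * s)) (p * y)"
        using less.prems(1) True by (cases g rule: bound.cases) (auto simp: corr_def mult.assoc)
      finally show ?thesis
        unfolding 1 by (simp add: Hq_def lift_diff 3)
    next
      case 1
      \<comment> \<open>Membership in \<open>pR\<close> expands the actions of both \<open>b\<close>
        and \<open>b * y\<close> by \<open>corr\<close>. Membership in \<open>Rp\<close> survives
        multiplication from the left, so the induction hypothesis applies to each term of the
        expansion.\<close>
      then have bI: "b \<in> pR" "b \<in> Rp" using basis_pR_Int_Rp(2) span_superset by blast+
      then have e: "hact g b = corr g b" "hact g (b * y) = corr g (b * y)"
        using gc right_ideal_mult by auto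
      from True less.prems(1) show ?thesis
      proof (cases rule: bound_cases)
        case (1 u k)
        have "deg k < deg g" using 1(1) by simp
        from less.hyps[OF this 1(3) left_ideal_mult[OF bI(2)]] show ?thesis
          by (simp only: e 1(4) mult.assoc)
      next
        case (2 g')
        let ?v = "hact g' (p * s)"
        have "?v \<in> span_words (normal_less (deg g'))"
          using hact_range(3)[of g'] 2 right_idealI by auto
        then have "lift (\<lambda>w. Hq (hact (Q # w) b) (p * y)) ?v = lift (\<lambda>w. hact (Q # w) (b * y)) ?v"
          using less.hyps 2 bI(2) by (intro lift_cong) (auto simp: normal_less_def)
        then have "Hq (Hq ?v b) (p * y) = Hq ?v (b * y)"
          by (simp add: Hq_def lift_lift)
        moreover have "Hq (hact g' (t * b)) (p * y) = hact g' (t * b * y)"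
          using less.hyps[of g'] 2 left_ideal_mult[OF bI(2)] by simp
        moreover have "Hq (v + v') x = Hq v x + Hq v' x" for v v' x
          by (simp add: Hq_def lift_add)
        ultimately show ?thesis
          by (simp only: e 2(4) mult.assoc)
      qed
    qed
  qed
  then show ?case
    using pr.linear_eq_on[OF lin1 lin2, of z Bxp] basis_Rp(3) less.prems(2) by auto
qed

end

section \<open>Presented algebras\<close>


lemma ring_ring_of_type_algebra: "ring (ring_of_type_algebra :: 'a::ring_1 ring)"
proof -
  have "\<exists>y. x + y = 0" for x :: 'a
    using add.right_inverse by blast
  then show ?thesis
    unfolding ring_of_type_algebra_def
    by unfold_locales (auto simp: algebra_simps Units_def)
qed

lemma ring_of_type_algebra_simps [simp]:
  "carrier ring_of_type_algebra = UNIV" "x \<otimes>\<^bsub>ring_of_type_algebra\<^esub> y = x * y"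
  "x \<oplus>\<^bsub>ring_of_type_algebra\<^esub> y = x + y" "\<zero>\<^bsub>ring_of_type_algebra\<^esub> = 0"
  "\<one>\<^bsub>ring_of_type_algebra\<^esub> = 1"
  by (simp_all add: ring_of_type_algebra_def)

lemma idealI_type:
  fixes I :: "'a::ring_1 set"
  assumes "0 \<in> I" "\<And>a b. a \<in> I \<Longrightarrow> b \<in> I \<Longrightarrow> a + b \<in> I" "\<And>a. a \<in> I \<Longrightarrow> - a \<in> I"
    "\<And>a x. a \<in> I \<Longrightarrow> x * a \<in> I" "\<And>a x. a \<in> I \<Longrightarrow> a * x \<in> I"
  shows "ideal I ring_of_type_algebra"
proof -
  interpret ring "ring_of_type_algebra :: 'a ring" by (rule ring_ring_of_type_algebra)
  have inv: "m_inv (add_monoid ring_of_type_algebra) a = - a" for a :: 'a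
    using minus_equality[of "- a" a] by (simp add: a_inv_def)
  show ?thesis
    by (rule idealI[OF ring_ring_of_type_algebra])
       (use assms inv[simplified] in \<open>auto intro!: subgroup.intro\<close>)
qed

lemma ideal_rel_ideal: "ideal (rel_ideal Rel) ring_of_type_algebra"
  unfolding rel_ideal_def
  by (rule ring.genideal_ideal[OF ring_ring_of_type_algebra]) simp

lemma rel_ideal_closed:
  shows "0 \<in> rel_ideal Rel"
    and "a \<in> rel_ideal Rel \<Longrightarrow> b \<in> rel_ideal Rel \<Longrightarrow> a + b \<in> rel_ideal Rel"
    and "a \<in> rel_ideal Rel \<Longrightarrow> - a \<in> rel_ideal Rel"
    and "a \<in> rel_ideal Rel \<Longrightarrow> b \<in> rel_ideal Rel \<Longrightarrow> a - b \<in> rel_ideal Rel"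
    and "a \<in> rel_ideal Rel \<Longrightarrow> f * a \<in> rel_ideal Rel"
    and "a \<in> rel_ideal Rel \<Longrightarrow> a * f \<in> rel_ideal Rel"
    and "a \<in> rel_ideal Rel \<Longrightarrow> fscale c a \<in> rel_ideal Rel"
    and "a \<in> Rel \<Longrightarrow> a \<in> rel_ideal Rel"
proof -
  interpret ideal "rel_ideal Rel" ring_of_type_algebra by (rule ideal_rel_ideal)
  show "0 \<in> rel_ideal Rel"
    using additive_subgroup.zero_closed[OF is_additive_subgroup] by simp
  show add: "a + b \<in> rel_ideal Rel" if "a \<in> rel_ideal Rel" "b \<in> rel_ideal Rel" for a b
    using additive_subgroup.a_closed[OF is_additive_subgroup that] by simp
  show mult: "f * a \<in> rel_ideal Rel" "a * f \<in> rel_ideal Rel" if "a \<in> rel_ideal Rel" for a f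
    using I_l_closed[OF that] I_r_closed[OF that] by auto
  show uminus: "- a \<in> rel_ideal Rel" if "a \<in> rel_ideal Rel" for a
    using mult(1)[OF that, of "- 1"] by simp
  show "a - b \<in> rel_ideal Rel" if "a \<in> rel_ideal Rel" "b \<in> rel_ideal Rel"
    using add[OF that(1) uminus[OF that(2)]] by simp
  show "fscale c a \<in> rel_ideal Rel" if "a \<in> rel_ideal Rel"
    using mult(1)[OF that] by (simp add: fscale_conv_mult)
  show "a \<in> rel_ideal Rel" if "a \<in> Rel"
    using that ring.genideal_self[OF ring_ring_of_type_algebra, of Rel] unfolding rel_ideal_def by auto
qed

lemma rel_ideal_minimal: "ideal I ring_of_type_algebra \<Longrightarrow> Rel \<subseteq> I \<Longrightarrow> rel_ideal Rel \<subseteq> I"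
  unfolding rel_ideal_def by (rule ring.genideal_minimal[OF ring_ring_of_type_algebra])

lemma quot_map_eq: "quot_map Rel f = {a + f | a. a \<in> rel_ideal Rel}"
  by (auto simp: quot_map_def a_r_coset_def r_coset_def)

lemma quot_map_eq_iff: "quot_map Rel f = quot_map Rel g \<longleftrightarrow> f - g \<in> rel_ideal Rel"
proof
  assume "quot_map Rel f = quot_map Rel g"
  moreover have "f \<in> quot_map Rel f" using rel_ideal_closed(1) by (auto simp: quot_map_eq)
  ultimately have "f \<in> quot_map Rel g" by simp
  then show "f - g \<in> rel_ideal Rel" by (auto simp: quot_map_eq)
next
  assume *: "f - g \<in> rel_ideal Rel"
  have "a + f \<in> quot_map Rel g" if "a \<in> rel_ideal Rel" for a
    unfolding quot_map_eq using rel_ideal_closed(2)[OF that *] by (intro CollectI exI[of _ "a + (f - g)"]) simp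
  moreover have "a + g \<in> quot_map Rel f" if "a \<in> rel_ideal Rel" for a
    unfolding quot_map_eq using rel_ideal_closed(4)[OF that *] by (intro CollectI exI[of _ "a - (f - g)"]) simp
  ultimately show "quot_map Rel f = quot_map Rel g" by (auto simp: quot_map_eq)
qed

lemma presented_algebra_simps:
  "carrier (presented_algebra Rel) = range (quot_map Rel)"
  "quot_map Rel f \<oplus>\<^bsub>presented_algebra Rel\<^esub> quot_map Rel g = quot_map Rel (f + g)"
  "\<zero>\<^bsub>presented_algebra Rel\<^esub> = quot_map Rel 0"
  "c \<odot>\<^bsub>presented_algebra Rel\<^esub> quot_map Rel f = quot_map Rel (fscale c f)"
proof -
  interpret ideal "rel_ideal Rel" ring_of_type_algebra by (rule ideal_rel_ideal)
  show "carrier (presented_algebra Rel) = range (quot_map Rel)"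
    by (auto simp: presented_algebra_def ring.defs monoid.defs module.defs FactRing_def A_RCOSETS_def'
        quot_map_def)
  show "quot_map Rel f \<oplus>\<^bsub>presented_algebra Rel\<^esub> quot_map Rel g = quot_map Rel (f + g)"
    using a_rcos_sum[of f g]
    by (simp add: presented_algebra_def ring.defs monoid.defs module.defs FactRing_def quot_map_def)
  have "quot_map Rel 0 = rel_ideal Rel" by (auto simp: quot_map_eq)
  then show "\<zero>\<^bsub>presented_algebra Rel\<^esub> = quot_map Rel 0"
    by (simp add: presented_algebra_def ring.defs monoid.defs module.defs FactRing_def)
  have 1: "quot_map Rel (fscale c g) = quot_map Rel (fscale c f)" if "g \<in> quot_map Rel f" for g
    unfolding quot_map_eq_iff using that rel_ideal_closed(7)
    by (auto simp: quot_map_eq simp flip: fa.scale_right_diff_distrib)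
  have 2: "f \<in> quot_map Rel f" using rel_ideal_closed(1) by (auto simp: quot_map_eq)
  have "c \<odot>\<^bsub>presented_algebra Rel\<^esub> quot_map Rel f = (\<Union>g\<in>quot_map Rel f. quot_map Rel (fscale c g))"
    by (simp add: presented_algebra_def ring.defs monoid.defs module.defs)
  also have "\<dots> = quot_map Rel (fscale c f)"
  proof (intro equalityI UN_least)
    show "quot_map Rel (fscale c f) \<subseteq> (\<Union>g\<in>quot_map Rel f. quot_map Rel (fscale c g))"
      using 2 by (rule UN_upper)
  qed (use 1 in blast)
  finally show "c \<odot>\<^bsub>presented_algebra Rel\<^esub> quot_map Rel f = quot_map Rel (fscale c f)" .
qed

lemma abelian_monoid_presented: "abelian_monoid (presented_algebra Rel)"
proof (rule abelian_monoidI)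
  fix x y z
  assume "x \<in> carrier (presented_algebra Rel)" "y \<in> carrier (presented_algebra Rel)"
    "z \<in> carrier (presented_algebra Rel)"
  then obtain f g h where "x = quot_map Rel f" "y = quot_map Rel g" "z = quot_map Rel h"
    by (auto simp: presented_algebra_simps)
  then show "x \<oplus>\<^bsub>presented_algebra Rel\<^esub> y \<in> carrier (presented_algebra Rel)"
    "x \<oplus>\<^bsub>presented_algebra Rel\<^esub> y \<oplus>\<^bsub>presented_algebra Rel\<^esub> z =
      x \<oplus>\<^bsub>presented_algebra Rel\<^esub> (y \<oplus>\<^bsub>presented_algebra Rel\<^esub> z)"
    "x \<oplus>\<^bsub>presented_algebra Rel\<^esub> y = y \<oplus>\<^bsub>presented_algebra Rel\<^esub> x"
    "\<zero>\<^bsub>presented_algebra Rel\<^esub> \<oplus>\<^bsub>presented_algebra Rel\<^esub> x = x"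
    by (simp_all add: presented_algebra_simps add_ac)
qed (auto simp: presented_algebra_simps)

lemma finsum_presented:
  assumes "finite S"
  shows "finsum (presented_algebra Rel) (\<lambda>i. quot_map Rel (f i)) S = quot_map Rel (sum f S)"
  using assms
proof (induction S)
  case empty
  then show ?case
    by (simp add: abelian_monoid.finsum_empty[OF abelian_monoid_presented] presented_algebra_simps)
next
  case (insert x S)
  then show ?case
    by (subst abelian_monoid.finsum_insert[OF abelian_monoid_presented])
       (auto simp: presented_algebra_simps)
qed

text \<open>In \<open>module_basis\<close> coefficients are indexed by cosets. Since words of
  \<open>W\<close> have distinct cosets, \<open>pull\<close> carries such coefficients back to
  combinations of words, where existence is \<open>span\<close> and uniqueness is
  \<open>indep\<close>.\<close>

lemma words_give_basis_presented:
  fixes Rel :: "('g, 'k::field) free_algebra set"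
  assumes span: "\<And>f. \<exists>g\<in>span_words W. f - g \<in> rel_ideal Rel"
    and indep: "\<And>f. f \<in> span_words W \<Longrightarrow> f \<in> rel_ideal Rel \<Longrightarrow> f = 0"
  shows "words_give_basis (presented_algebra Rel) (quot_map Rel) W"
proof -
  let ?w = "\<lambda>w. quot_map Rel (word w :: ('g, 'k) free_algebra)"
  let ?P = "presented_algebra Rel"
  have inj: "inj_on ?w W"
  proof (rule inj_onI)
    fix u v assume uv: "u \<in> W" "v \<in> W" "?w u = ?w v"
    then have "word u - word v = (0 :: ('g, 'k) free_algebra)"
      by (intro indep) (auto simp: quot_map_eq_iff span_words_diff)
    then have "word u = (word v :: ('g, 'k) free_algebra)" by simp
    then have "Poly_Mapping.keys (word u :: ('g, 'k) free_algebra) = Poly_Mapping.keys (word v :: ('g, 'k) free_algebra)" by simp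
    then show "u = v" by simp
  qed
  define pull where "pull c = (\<Sum>w\<in>{w\<in>W. ?w w \<in> Poly_Mapping.keys c}.
    fscale (Poly_Mapping.lookup c (?w w)) (word w))" for c :: "_ \<Rightarrow>\<^sub>0 'k"
  have fin: "finite {w\<in>W. ?w w \<in> Poly_Mapping.keys c}" for c :: "_ \<Rightarrow>\<^sub>0 'k"
    using finite_vimage_IntI[OF finite_keys inj, of c] by (rule rev_finite_subset) auto
  have sum: "finsum ?P (\<lambda>x. Poly_Mapping.lookup c x \<odot>\<^bsub>?P\<^esub> x) (Poly_Mapping.keys c) = quot_map Rel (pull c)"
    if c: "Poly_Mapping.keys c \<subseteq> ?w ` W" for c
  proof -
    let ?S = "{w\<in>W. ?w w \<in> Poly_Mapping.keys c}"
    have k: "Poly_Mapping.keys c = ?w ` ?S" using c by auto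
    have i: "inj_on ?w ?S" using inj by (rule inj_on_subset) auto
    interpret abelian_monoid ?P by (rule abelian_monoid_presented)
    have "finsum ?P (\<lambda>x. Poly_Mapping.lookup c x \<odot>\<^bsub>?P\<^esub> x) (?w ` ?S) =
      finsum ?P (\<lambda>w. Poly_Mapping.lookup c (?w w) \<odot>\<^bsub>?P\<^esub> ?w w) ?S"
      by (rule finsum_reindex[OF _ i]) (auto simp: presented_algebra_simps)
    also have "\<dots> = quot_map Rel (pull c)"
      by (simp add: presented_algebra_simps finsum_presented[OF fin] pull_def)
    finally show ?thesis using k by simp
  qed
  have pull_span: "pull c \<in> span_words W" for c
    unfolding pull_def by (intro span_words_sum span_words_scale) auto
  have lookup_pull: "Poly_Mapping.lookup (pull c) w = Poly_Mapping.lookup c (?w w)" if "w \<in> W" for c w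
    using that fin[of c] by (auto simp: pull_def lookup_sum lookup_word sum.delta' in_keys_iff if_distrib cong: if_cong)
  have "\<exists>!c. Poly_Mapping.keys c \<subseteq> ?w ` W \<and>
     v = finsum ?P (\<lambda>x. Poly_Mapping.lookup c x \<odot>\<^bsub>?P\<^esub> x) (Poly_Mapping.keys c)"
    if v: "v \<in> carrier ?P" for v
  proof -
    obtain f where "v = quot_map Rel f" using v by (auto simp: presented_algebra_simps)
    then obtain g where g: "g \<in> span_words W" "v = quot_map Rel g"
      using span[of f] quot_map_eq_iff by blast
    define c where "c = (\<Sum>w\<in>Poly_Mapping.keys g. Poly_Mapping.single (?w w) (Poly_Mapping.lookup g w))"
    have kg: "Poly_Mapping.keys g \<subseteq> W" using g by (simp add: span_words_def)
    have lc: "Poly_Mapping.lookup c (?w w) = Poly_Mapping.lookup g w" if "w \<in> W" for w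
    proof -
      have "Poly_Mapping.lookup c (?w w) = (\<Sum>v\<in>Poly_Mapping.keys g. if v = w then Poly_Mapping.lookup g v else 0)"
        unfolding c_def lookup_sum lookup_single when_def
        by (rule sum.cong) (use kg that inj in \<open>auto dest: inj_onD\<close>)
      then show ?thesis by (simp add: sum.delta' in_keys_iff)
    qed
    have kc: "Poly_Mapping.keys c \<subseteq> ?w ` W"
    proof
      fix x assume "x \<in> Poly_Mapping.keys c"
      then have "\<exists>w\<in>Poly_Mapping.keys g. x \<in> Poly_Mapping.keys (Poly_Mapping.single (?w w) (Poly_Mapping.lookup g w))"
        unfolding c_def in_keys_iff lookup_sum by (blast elim: sum.not_neutral_contains_not_neutral)
      then show "x \<in> ?w ` W" using kg by (auto split: if_splits)
    qed
    have eqI: "pull c = h" if "h \<in> span_words W" "\<And>w. w \<in> W \<Longrightarrow> Poly_Mapping.lookup h w = Poly_Mapping.lookup c (?w w)" for c h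
    proof (rule poly_mapping_eqI)
      fix w
      show "Poly_Mapping.lookup (pull c) w = Poly_Mapping.lookup h w"
      proof (cases "w \<in> W")
        case True
        then show ?thesis using that(2) lookup_pull by simp
      next
        case False
        then have "w \<notin> Poly_Mapping.keys (pull c)" "w \<notin> Poly_Mapping.keys h"
          using that(1) pull_span[of c] unfolding span_words_def by blast+
        then show ?thesis by (simp add: in_keys_iff)
      qed
    qed
    show ?thesis
    proof (rule ex1I[of _ c], intro conjI kc)
      show "v = finsum ?P (\<lambda>x. Poly_Mapping.lookup c x \<odot>\<^bsub>?P\<^esub> x) (Poly_Mapping.keys c)"
        using sum[OF kc] g eqI[of g c] lc by simp
    next
      fix d assume d: "Poly_Mapping.keys d \<subseteq> ?w ` W \<and>
        v = finsum ?P (\<lambda>x. Poly_Mapping.lookup d x \<odot>\<^bsub>?P\<^esub> x) (Poly_Mapping.keys d)"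
      then have "quot_map Rel (pull d) = quot_map Rel g" using sum g by simp
      then have "pull d - g = 0"
        using g pull_span by (intro indep span_words_diff) (auto simp: quot_map_eq_iff)
      then have "Poly_Mapping.lookup d (?w w) = Poly_Mapping.lookup c (?w w)" if "w \<in> W" for w
        using lookup_pull[OF that, of d] lc[OF that] by simp
      then have "Poly_Mapping.lookup d x = Poly_Mapping.lookup c x" for x
      proof (cases "x \<in> ?w ` W")
        case False
        then have "x \<notin> Poly_Mapping.keys d" "x \<notin> Poly_Mapping.keys c" using d kc by blast+
        then show ?thesis by (simp add: in_keys_iff)
      qed auto
      then show "d = c" by (rule poly_mapping_eqI)
    qed
  qed
  then show ?thesis
    using inj unfolding words_give_basis_def module_basis_def by (auto simp: presented_algebra_simps)
qed

context inner_inverse_bases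
begin

section \<open>Independence of the normal words\<close>

abbreviation "rels \<equiv> inner_inverse_rels scale p"

fun letter_act :: "'r gen \<Rightarrow> ('r gen, 'k) free_algebra \<Rightarrow> ('r gen, 'k) free_algebra" where
  "letter_act (Elt r) v = act v r"
| "letter_act Q v = qact v"

text \<open>The free algebra acting from the right: \<open>fold\<close> applies the leftmost letter
  first, so a product acts by its left factor first. The operators exist for all combinations of
  words; the relations of \<open>R'\<close> are verified on \<open>V\<close>.\<close>

definition rep :: "('r gen, 'k) free_algebra \<Rightarrow> ('r gen, 'k) free_algebra \<Rightarrow> ('r gen, 'k) free_algebra"
  where "rep f v = lift (\<lambda>w. fold letter_act w v) f"

lemma letter_act_add: "letter_act g (v + v') = letter_act g v + letter_act g v'"
  and letter_act_scale: "letter_act g (fscale c v) = fscale c (letter_act g v)"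
  by (cases g; simp add: act_def qact_def lift_add lift_scale)+

lemma fold_letter_act_add: "fold letter_act w (v + v') = fold letter_act w v + fold letter_act w v'"
  by (induction w arbitrary: v v') (simp_all add: letter_act_add)

lemma fold_letter_act_scale: "fold letter_act w (fscale c v) = fscale c (fold letter_act w v)"
  by (induction w arbitrary: v) (simp_all add: letter_act_scale)

lemma fold_letter_act_sum: "fold letter_act w (sum f I) = (\<Sum>i\<in>I. fold letter_act w (f i))"
proof -
  have "fold letter_act w 0 = 0" using fold_letter_act_scale[of w 0 0] by simp
  then show ?thesis by (induction I rule: infinite_finite_induct) (simp_all add: fold_letter_act_add)
qed

lemma rep_add_right: "rep f (v + v') = rep f v + rep f v'"
  by (simp add: rep_def fold_letter_act_add lift_fun_add)

lemma rep_word: "rep (word w) v = fold letter_act w v"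
  by (simp add: rep_def)

lemma rep_add: "rep (f + g) v = rep f v + rep g v"
  and rep_diff: "rep (f - g) v = rep f v - rep g v"
  and rep_scale: "rep (fscale c f) v = fscale c (rep f v)"
  by (simp_all add: rep_def lift_add lift_diff lift_scale)

lemma rep_one: "rep 1 v = v"
  using rep_word[of "[]" v] by (simp add: word_Nil)

lemma rep_mult: "rep (f * g) v = rep g (rep f v)"
proof -
  let ?F = "Poly_Mapping.keys f" and ?G = "Poly_Mapping.keys g"
  let ?f = "Poly_Mapping.lookup f" and ?g = "Poly_Mapping.lookup g"
  have "f * g = (\<Sum>w\<in>?F. fscale (?f w) (word w)) * (\<Sum>w\<in>?G. fscale (?g w) (word w))"
    using free_algebra_expand[of f] free_algebra_expand[of g] by simp
  also have "\<dots> = (\<Sum>w\<in>?F. \<Sum>w'\<in>?G. fscale (?f w) (fscale (?g w') (word (w @ w'))))"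
    by (simp add: sum_product word_append fscale_mult_right flip: fscale_mult_left)
  finally have "rep (f * g) v = (\<Sum>w\<in>?F. \<Sum>w'\<in>?G. fscale (?f w) (fscale (?g w') (fold letter_act w' (fold letter_act w v))))"
    by (simp add: rep_def lift_sum lift_scale)
  also have "\<dots> = (\<Sum>w'\<in>?G. fscale (?g w') (\<Sum>w\<in>?F. fscale (?f w) (fold letter_act w' (fold letter_act w v))))"
    by (subst sum.swap) (simp add: fa.scale_sum_right mult.commute)
  also have "\<dots> = rep g (rep f v)"
    by (simp add: rep_def lift_def fold_letter_act_sum fold_letter_act_scale)
  finally show ?thesis .
qed

abbreviation "V \<equiv> span_words (Collect rnormal) :: ('r gen, 'k) free_algebra set"

lemma act_V: "v \<in> V \<Longrightarrow> act v r \<in> V"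
  unfolding act_def
  by (rule lift_in_span_words) (auto elim!: rnormal_cases simp: wact_simps intro: hact_rnormal)

lemma qact_V: "v \<in> V \<Longrightarrow> qact v \<in> V"
  unfolding qact_def by (rule lift_in_span_words) auto

lemma fold_letter_act_V: "v \<in> V \<Longrightarrow> fold letter_act w v \<in> V"
proof (induction w arbitrary: v)
  case (Cons g w)
  then show ?case by (cases g) (auto simp: act_V qact_V)
qed simp

lemma rep_V: "v \<in> V \<Longrightarrow> rep f v \<in> V"
  unfolding rep_def by (rule lift_in_span_words[of _ UNIV]) (auto simp: fold_letter_act_V span_words_def[of UNIV])

lemma act_act: "v \<in> V \<Longrightarrow> act (act v x) y = act v (x * y)"
  unfolding act_def lift_lift
  by (rule lift_cong, assumption)
    (auto elim!: rnormal_cases simp: wact_simps act_hact mult.assoc simp flip: act_def)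

lemma act_one: "v \<in> V \<Longrightarrow> act v 1 = v"
proof -
  have "wact w 1 = word w" if "rnormal w" for w
    using that by (cases rule: rnormal_cases)
      (use that in \<open>simp_all add: wact_simps hact_one hact_put del: rnormal.simps\<close>)
  moreover assume "v \<in> V"
  ultimately have "act v 1 = lift word v"
    unfolding act_def by (intro lift_cong) auto
  then show ?thesis by (simp add: lift_word_id)
qed

text \<open>Acting by \<open>p\<close> turns each word into some \<open>hact g z\<close> with
  \<open>z\<close> in \<open>Rp\<close>, and acting by q and then \<open>p\<close> is
  \<open>Hq\<close>; so \<open>Hq_hact\<close> with \<open>y = 1\<close> applies.\<close>

lemma act_pqp: "v \<in> V \<Longrightarrow> act (qact (act v p)) p = act v p"
proof -
  assume v: "v \<in> V"
  have "act (qact f) r = Hq f r" for f r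
    by (simp add: act_def qact_def Hq_def lift_lift wact_def)
  moreover have "Hq (wact w p) p = wact w p" if "rnormal w" for w
    using that
  proof (cases rule: rnormal_cases)
    case 1
    then show ?thesis using Hq_hact[of w p 1] left_idealI[of 1] by (simp add: wact_simps)
  next
    case (2 b g)
    then show ?thesis using Hq_hact[of g "b * p" 1] left_idealI[of b] by (simp add: wact_simps)
  qed
  then have "Hq (act v p) p = act v p"
    unfolding Hq_def act_def lift_lift by (intro lift_cong[OF v]) auto
  ultimately show ?thesis by simp
qed

text \<open>The annihilator of \<open>V\<close> is a two-sided ideal, because \<open>V\<close> is
  stable under the action, and it contains the defining relations.\<close>

lemma rel_ideal_annihilates:
  assumes "f \<in> rel_ideal rels" "v \<in> V"
  shows "rep f v = 0"
proof -
  let ?K = "{f. \<forall>v\<in>V. rep f v = 0}"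
  have rep0: "rep f 0 = 0" for f using rep_add_right[of f 0 0] by simp
  have "ideal ?K ring_of_type_algebra"
  proof (rule idealI_type)
    show "- a \<in> ?K" if "a \<in> ?K" for a
      using that rep_scale[of "-1" a] by (simp flip: fa.scale_minus_left)
  qed (auto simp: rep_add rep_mult rep0 rep_V rep_def[of 0])
  moreover have "rels \<subseteq> ?K"
    unfolding inner_inverse_rels_def
    by (auto simp: rep_diff rep_add rep_scale rep_word rep_mult rep_one act_act act_one act_pqp)
       (simp_all add: act_def wact_add wact_scale lift_fun_add lift_fun_scale)
  ultimately show ?thesis using rel_ideal_minimal assms by blast
qed

lemma fold_rnormal: "rnormal w \<Longrightarrow> fold letter_act (rev w) (word []) = word w"
proof (induction w)
  case (Cons g w)
  then have "rnormal w" by (cases g) auto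
  moreover have "letter_act g (word w) = word (g # w)"
    using Cons.prems headD[of _ w]
    by (cases g) (auto simp: qact_def act_def wact_simps hact_put simp del: rnormal.simps)
  ultimately show ?case using Cons.IH by simp
qed simp

text \<open>Applied to the empty word, a combination of normal words reproduces itself with its
  words reversed. If it lies in the ideal, the result is 0, and a second reversal recovers
  \<open>f = 0\<close>.\<close>

lemma normal_independent:
  assumes "f \<in> span_words (rev ` Collect rnormal)" "f \<in> rel_ideal rels"
  shows "f = 0"
proof -
  have "word [] \<in> V" by simp
  then have 0: "rep f (word []) = 0" by (rule rel_ideal_annihilates[OF assms(2)])
  have "rep f (word []) = lift (\<lambda>w. word (rev w)) f"
    unfolding rep_def using assms(1) by (rule lift_cong) (auto simp: fold_rnormal)
  then have "lift (\<lambda>w. word (rev w)) (lift (\<lambda>w. word (rev w)) f) = 0" using 0 by simp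
  then show "f = 0" by (simp add: lift_lift lift_word_id)
qed


section \<open>Normal words\<close>

lemma bound_iff: "bound w \<longleftrightarrow> (\<exists>n u g. n \<ge> 1 \<and> u \<in> Bxp \<and> w = replicate n Q @ Elt u # g)"
proof
  show "bound w \<Longrightarrow> \<exists>n u g. n \<ge> 1 \<and> u \<in> Bxp \<and> w = replicate n Q @ Elt u # g"
  proof (induction w rule: bound.induct)
    case (3 w)
    then consider "bound w" | u g where "u \<in> Bxp" "w = Elt u # g" by auto
    then show ?case
    proof cases
      case 1
      then obtain n u g where "n \<ge> 1" "u \<in> Bxp" "w = replicate n Q @ Elt u # g" using 3 by blast
      then show ?thesis by (intro exI[of _ "Suc n"]) auto
    next
      case 2
      then show ?thesis by (intro exI[of _ 1] exI[of _ u] exI[of _ g]) simp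
    qed
  qed auto
next
  have "bound (replicate (Suc n) Q @ Elt u # g)" if "u \<in> Bxp" for n u g
    by (induction n) (use that in auto)
  then show "\<exists>n u g. n \<ge> 1 \<and> u \<in> Bxp \<and> w = replicate n Q @ Elt u # g \<Longrightarrow> bound w"
    by (metis Suc_le_D One_nat_def)
qed

text \<open>Induction on the length in reading order: an occurrence of a forbidden word that appears
  on appending a letter must be a suffix, hence a prefix of the reversed word. Appending q creates
  none, as no forbidden word ends in q.\<close>

lemma rnormal_iff:
  "rnormal w \<longleftrightarrow> rev w \<in> lists (Elt ` Bas \<union> {Q}) \<and>
    (\<forall>f\<in>forbidden_words p s t Bas Bxp Bpy. \<not> sublist f (rev w))"
proof -
  let ?F = "forbidden_words p s t Bas Bxp Bpy"
  have snoc: "(\<forall>f\<in>?F. \<not> sublist f (rev (g # w))) \<longleftrightarrow>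
    (\<forall>f\<in>?F. \<not> sublist f (rev w)) \<and> (\<forall>f\<in>?F. \<not> prefix (rev f) (g # w))" for g w
    by (auto simp: sublist_snoc suffix_to_prefix)
  have step: "(\<forall>f\<in>?F. \<not> prefix (rev f) (Elt b # w)) \<longleftrightarrow> b \<noteq> p * s \<and> (\<forall>c g. w \<noteq> Elt c # g) \<and>
     (bound w \<longrightarrow> b \<notin> Bpy \<and> b \<noteq> t * p)"
    if "b \<in> Bas" "w \<in> lists (Elt ` Bas \<union> {Q})" for b w
  proof -
    have bw: "bound w \<longleftrightarrow> (\<exists>n\<ge>1. \<exists>u\<in>Bxp. prefix (replicate n Q @ [Elt u]) w)"
      unfolding bound_iff prefix_def by auto
    have 1: "(\<forall>f\<in>{[Elt x, Elt y] | x y. x \<in> Bas \<and> y \<in> Bas}. \<not> prefix (rev f) (Elt b # w)) \<longleftrightarrow>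
        (\<forall>c g. w \<noteq> Elt c # g)"
    proof -
      have "c \<in> Bas" if "w = Elt c # g" for c g
        using \<open>w \<in> lists _\<close> unfolding that by (simp add: image_iff del: Un_iff)
      moreover have "prefix (rev [Elt x, Elt y]) (Elt b # w) \<longleftrightarrow> y = b \<and> (\<exists>g. w = Elt x # g)" for x y
        by (cases w) auto
      ultimately show ?thesis using \<open>b \<in> Bas\<close> by blast
    qed
    have 2: "(\<forall>f\<in>{[Elt (p * s)]}. \<not> prefix (rev f) (Elt b # w)) \<longleftrightarrow> b \<noteq> p * s"
      by auto
    have pre: "prefix (rev ([Elt u] @ replicate n Q @ [Elt y])) (Elt b # w) \<longleftrightarrow>
        y = b \<and> prefix (replicate n Q @ [Elt u]) w" for u y n
      by auto
    have 3: "(\<forall>f\<in>{[Elt u] @ replicate n Q @ [Elt w] | u n w. u \<in> Bxp \<and> w \<in> Bpy \<and> n \<ge> 1}.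
        \<not> prefix (rev f) (Elt b # w)) \<longleftrightarrow> (bound w \<longrightarrow> b \<notin> Bpy)"
      (is "?L3 \<longleftrightarrow> _")
    proof -
      have "?L3 \<longleftrightarrow> (\<forall>u n y. u \<in> Bxp \<and> y \<in> Bpy \<and> n \<ge> 1 \<longrightarrow>
          \<not> prefix (rev ([Elt u] @ replicate n Q @ [Elt y])) (Elt b # w))"
        by blast
      then show ?thesis unfolding bw pre by blast
    qed
    have 4: "(\<forall>f\<in>{[Elt u] @ replicate n Q @ [Elt (t * p)] | u n. u \<in> Bxp \<and> n \<ge> 1}.
        \<not> prefix (rev f) (Elt b # w)) \<longleftrightarrow> (bound w \<longrightarrow> b \<noteq> t * p)"
      (is "?L4 \<longleftrightarrow> _")
    proof -
      have "?L4 \<longleftrightarrow> (\<forall>u n. u \<in> Bxp \<and> n \<ge> 1 \<longrightarrow>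
          \<not> prefix (rev ([Elt u] @ replicate n Q @ [Elt (t * p)])) (Elt b # w))"
        by blast
      then show ?thesis unfolding bw pre by blast
    qed
    show ?thesis
      unfolding forbidden_words_def ball_Un 1 2 3 4 by blast
  qed
  have stepQ: "\<forall>f\<in>?F. \<not> prefix (rev f) (Q # w)" for w
    by (auto simp: forbidden_words_def)
  show ?thesis
  proof (induction w)
    case Nil
    show ?case by (auto simp: forbidden_words_def)
  next
    case (Cons g w)
    show ?case
    proof (cases g)
      case (Elt b)
      have "rnormal (g # w) \<longleftrightarrow> b \<in> Bas \<and> rnormal w \<and> b \<noteq> p * s \<and> (\<forall>c g. w \<noteq> Elt c # g) \<and>
          (bound w \<longrightarrow> b \<notin> Bpy \<and> b \<noteq> t * p)"
        unfolding Elt rnormal.simps by blast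
      also have "\<dots> \<longleftrightarrow> b \<in> Bas \<and> rnormal w \<and> (\<forall>f\<in>?F. \<not> prefix (rev f) (g # w))"
        using step[of b w] Cons.IH unfolding Elt in_lists_conv_set set_rev by blast
      also have "\<dots> \<longleftrightarrow> rev (g # w) \<in> lists (Elt ` Bas \<union> {Q}) \<and> (\<forall>f\<in>?F. \<not> sublist f (rev (g # w)))"
        unfolding snoc Cons.IH using Elt by (auto simp del: Un_iff)
      finally show ?thesis .
    next
      case Q
      then show ?thesis using Cons.IH snoc[of g w] stepQ[of w] by auto
    qed
  qed
qed

lemma normal_words_eq: "normal_words p s t Bas Bxp Bpy = rev ` Collect rnormal"
proof -
  have "w \<in> normal_words p s t Bas Bxp Bpy \<longleftrightarrow> rnormal (rev w)" for w
    unfolding rnormal_iff normal_words_def by simp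
  moreover have "w \<in> rev ` Collect rnormal \<longleftrightarrow> rnormal (rev w)" for w
    by (auto simp: image_iff intro!: exI[of _ "rev w"])
  ultimately show ?thesis by blast
qed

end

section \<open>Sums over sets without adjacent elements\<close>

text \<open>\<open>T_index k\<close> with the empty set added; including it gives the sums a
  recursion in \<open>k\<close>.\<close>

definition nonadj :: "nat \<Rightarrow> nat set set"
  where "nonadj k = {M. M \<subseteq> {..<k} \<and> (\<forall>i\<in>M. Suc i \<notin> M)}"

lemma finite_nonadj [simp]: "finite (nonadj k)"
  by (rule finite_subset[of _ "Pow {..<k}"]) (auto simp: nonadj_def)

lemma nonadj_Suc_notin: "{M \<in> nonadj (Suc k). k \<notin> M} = nonadj k"
  by (auto simp: nonadj_def less_Suc_eq)

text \<open>A mark on the last position forces the previous one to be unmarked; erasing that mark is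
  a bijection. This is why \<open>marked_sum_Suc\<close> involves only
  \<open>unmarked_sum\<close>.\<close>

lemma nonadj_Suc_in: "{M \<in> nonadj (Suc (Suc k)). Suc k \<in> M} = insert (Suc k) ` {M \<in> nonadj (Suc k). k \<notin> M}"
proof (intro equalityI subsetI)
  fix M assume M: "M \<in> {M \<in> nonadj (Suc (Suc k)). Suc k \<in> M}"
  then have "M = insert (Suc k) (M - {Suc k})" by auto
  moreover have "M - {Suc k} \<in> {M \<in> nonadj (Suc k). k \<notin> M}"
    using M by (auto simp: nonadj_def less_Suc_eq)
  ultimately show "M \<in> insert (Suc k) ` {M \<in> nonadj (Suc k). k \<notin> M}" by blast
qed (auto simp: nonadj_def less_Suc_eq)

lemma sum_nonadj_split:
  fixes G :: "nat set \<Rightarrow> 'a::comm_monoid_add"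
  shows "sum G {M \<in> nonadj (Suc (Suc k)). Suc k \<in> M} = (\<Sum>M\<in>{M \<in> nonadj (Suc k). k \<notin> M}. G (insert (Suc k) M))"
    and "sum G (nonadj (Suc k)) = sum G {M \<in> nonadj (Suc k). k \<notin> M} + sum G {M \<in> nonadj (Suc k). k \<in> M}"
proof -
  have "Suc k \<notin> M" if "M \<in> nonadj (Suc k)" for M using that by (auto simp: nonadj_def)
  then have "inj_on (insert (Suc k)) {M \<in> nonadj (Suc k). k \<notin> M}"
    by (intro inj_onI) (metis (no_types, lifting) insert_ident mem_Collect_eq)
  then show "sum G {M \<in> nonadj (Suc (Suc k)). Suc k \<in> M} = (\<Sum>M\<in>{M \<in> nonadj (Suc k). k \<notin> M}. G (insert (Suc k) M))"
    unfolding nonadj_Suc_in by (simp add: sum.reindex)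
  have "nonadj (Suc k) = {M \<in> nonadj (Suc k). k \<notin> M} \<union> {M \<in> nonadj (Suc k). k \<in> M}" by blast
  then show "sum G (nonadj (Suc k)) = sum G {M \<in> nonadj (Suc k). k \<notin> M} + sum G {M \<in> nonadj (Suc k). k \<in> M}"
    by (metis (mono_tags, lifting) sum.union_disjoint finite_nonadj finite_Un Int_emptyI mem_Collect_eq)
qed

text \<open>\<open>pw\<close> is the signed product of the first \<open>k\<close> factors of a member of \<open>T\<close>.  In \<open>R'\<close>, the sum
  \<open>U\<close> of these over all \<open>M\<close> that leave the \<open>k\<close>th letter \<open>q\<close> unmarked and the sum \<open>V\<close> over all other
  \<open>M\<close> satisfy \<open>U ps + V = 0\<close>; this is what makes the signed sums over \<open>T\<close> collapse.\<close>

definition pw :: "'a::ring_1 \<Rightarrow> 'a \<Rightarrow> 'a \<Rightarrow> 'a \<Rightarrow> nat \<Rightarrow> nat set \<Rightarrow> 'a"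
  where "pw a a' m q k M = (if even (card M) then 1 else - 1) *
    ((if 0 \<in> M then a' else a) * (\<Prod>i\<leftarrow>[1..<k]. if i \<in> M then m else q))"

definition unmarked_sum :: "'a::ring_1 \<Rightarrow> 'a \<Rightarrow> 'a \<Rightarrow> 'a \<Rightarrow> nat \<Rightarrow> 'a"
  where "unmarked_sum a a' m q k = (\<Sum>M\<in>{M \<in> nonadj (Suc k). k \<notin> M}. pw a a' m q (Suc k) M)"

definition marked_sum :: "'a::ring_1 \<Rightarrow> 'a \<Rightarrow> 'a \<Rightarrow> 'a \<Rightarrow> nat \<Rightarrow> 'a"
  where "marked_sum a a' m q k = (\<Sum>M\<in>{M \<in> nonadj (Suc k). k \<in> M}. pw a a' m q (Suc k) M)"

lemma pw_Suc: "M \<in> nonadj (Suc k) \<Longrightarrow> pw a a' m q (Suc (Suc k)) M = pw a a' m q (Suc k) M * q"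
  by (auto simp: pw_def nonadj_def mult.assoc)

lemma card_insert_nonadj: "M \<in> nonadj k \<Longrightarrow> card (insert k M) = Suc (card M)"
  by (subst card_insert_disjoint) (auto simp: nonadj_def intro: finite_subset)

lemma pw_Suc_insert:
  assumes "M \<in> nonadj (Suc k)"
  shows "pw a a' m q (Suc (Suc k)) (insert (Suc k) M) = - (pw a a' m q (Suc k) M * m)"
proof -
  have m: "map (\<lambda>i. if i = Suc k \<or> i \<in> M then m else q) [Suc 0..<Suc k] =
      map (\<lambda>i. if i \<in> M then m else q) [Suc 0..<Suc k]"
    by auto
  have "(\<Prod>i\<leftarrow>[1..<Suc (Suc k)]. if i \<in> insert (Suc k) M then m else q) =
      (\<Prod>i\<leftarrow>[1..<Suc k]. if i \<in> M then m else q) * m"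
    by (subst upt_Suc_append) (simp_all add: m del: upt_Suc)
  then show ?thesis
    unfolding pw_def using card_insert_nonadj[OF assms] by (simp add: mult.assoc del: upt_Suc)
qed

lemma unmarked_sum_0: "unmarked_sum a a' m q 0 = a"
proof -
  have "{M \<in> nonadj (Suc 0). 0 \<notin> M} = {{}}" by (auto simp: nonadj_def)
  then show ?thesis by (simp add: unmarked_sum_def pw_def)
qed

lemma marked_sum_0: "marked_sum a a' m q 0 = - a'"
proof -
  have "{M \<in> nonadj (Suc 0). 0 \<in> M} = {{0}}" by (auto simp: nonadj_def)
  then show ?thesis by (simp add: marked_sum_def pw_def)
qed

lemma unmarked_sum_Suc: "unmarked_sum a a' m q (Suc k) = (unmarked_sum a a' m q k + marked_sum a a' m q k) * q"
  unfolding unmarked_sum_def marked_sum_def sum_nonadj_split(2)[symmetric]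
  by (simp add: nonadj_Suc_notin sum_distrib_right pw_Suc)

lemma marked_sum_Suc: "marked_sum a a' m q (Suc k) = - (unmarked_sum a a' m q k * m)"
  unfolding unmarked_sum_def marked_sum_def sum_nonadj_split(1)
  by (simp add: sum_distrib_right sum_negf pw_Suc_insert)

text \<open>With \<open>f\<close> = ps and \<open>m\<close> = tps: modulo the ideal the induction
  hypothesis says V = - U f, so U + V = U (1 - f), and (1 - f) q f is \<open>m\<close>. Thus the
  next U times \<open>f\<close> cancels the next V.\<close>

lemma prefix_sum_in_rel_ideal:
  assumes "a * f - a' \<in> rel_ideal Rel" "(1 - f) * q * f - m \<in> rel_ideal Rel"
  shows "unmarked_sum a a' m q k * f + marked_sum a a' m q k \<in> rel_ideal Rel"
proof (induction k)
  case 0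
  then show ?case using assms by (simp add: unmarked_sum_0 marked_sum_0)
next
  case (Suc k)
  let ?U = "unmarked_sum a a' m q k" and ?V = "marked_sum a a' m q k"
  have "unmarked_sum a a' m q (Suc k) * f + marked_sum a a' m q (Suc k) =
      (?U * f + ?V) * (q * f) + ?U * ((1 - f) * q * f - m)"
    by (simp add: unmarked_sum_Suc marked_sum_Suc algebra_simps)
  then show ?case
    using rel_ideal_closed(2)[OF rel_ideal_closed(6)[OF Suc] rel_ideal_closed(5)[OF assms(2)]] by simp
qed

text \<open>Again U + V = U (1 - f) modulo the ideal, and the last q with its right neighbour,
  \<open>l\<close> = q py, satisfies (1 - f) l = tpy = \<open>l'\<close>. So the signed sum over all
  markings, the empty one included, vanishes in \<open>R'\<close>.\<close>

lemma total_in_rel_ideal: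
  assumes "a * f - a' \<in> rel_ideal Rel" "(1 - f) * q * f - m \<in> rel_ideal Rel" "(1 - f) * l - l' \<in> rel_ideal Rel"
  shows "(unmarked_sum a a' m q k + marked_sum a a' m q k) * l - unmarked_sum a a' m q k * l' \<in> rel_ideal Rel"
proof -
  let ?U = "unmarked_sum a a' m q k" and ?V = "marked_sum a a' m q k"
  have "(?U + ?V) * l - ?U * l' = (?U * f + ?V) * l + ?U * ((1 - f) * l - l')"
    by (simp add: algebra_simps)
  then show ?thesis
    using rel_ideal_closed(2)[OF rel_ideal_closed(6)[OF prefix_sum_in_rel_ideal[OF assms(1,2)]]
        rel_ideal_closed(5)[OF assms(3)]] by simp
qed

text \<open>The signs in \<open>T_member\<close> are opposite to those of \<open>pw\<close>, and
  \<open>T_index\<close> omits the empty marking. Of the k + 2 letters q, the first k + 1 belong to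
  the sums U and V; the last one is split off together with \<open>p * y\<close>.\<close>

lemma T_sum_eq:
  fixes nf :: "'r::ring_1 \<Rightarrow> ('r gen, 'k::field) free_algebra" and p s t x y :: 'r
  defines "a \<equiv> letter (Elt (x * p)) * letter Q"
  shows "T_sum nf p s t x (Suc (Suc k)) y =
    a * letter Q ^ k * (letter Q * letter (Elt (p * y))) -
    ((unmarked_sum (a) (nf (x * p * s)) (nf (t * p * s)) (letter Q) k +
      marked_sum (a) (nf (x * p * s)) (nf (t * p * s)) (letter Q) k) * (letter Q * letter (Elt (p * y))) -
     unmarked_sum (a) (nf (x * p * s)) (nf (t * p * s)) (letter Q) k * nf (t * p * y))"
proof -
  let ?l = "letter Q * letter (Elt (p * y)) :: ('r gen, 'k) free_algebra" and ?l' = "nf (t * p * y)"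
  let ?U = "unmarked_sum (a) (nf (x * p * s)) (nf (t * p * s)) (letter Q) k"
  let ?V = "marked_sum (a) (nf (x * p * s)) (nf (t * p * s)) (letter Q) k"
  let ?p = "pw (a) (nf (x * p * s)) (nf (t * p * s)) (letter Q) (Suc k)"
  let ?G = "T_member nf p s t x (Suc (Suc k)) y"
  have 1: "?G M = - (?p M * ?l)" if "M \<in> nonadj (Suc k)" for M
  proof -
    have "Suc k \<notin> M" using that by (auto simp: nonadj_def)
    then show ?thesis by (simp add: T_member_def pw_def a_def mult.assoc[where 'a = "('r gen, 'k) free_algebra"] del: upt_Suc)
  qed
  have 2: "?G (insert (Suc k) M) = ?p M * ?l'" if "M \<in> nonadj (Suc k)" for M
  proof -
    have m: "map (\<lambda>i. if i = Suc k \<or> i \<in> M then b else c) [Suc 0..<Suc k] = map (\<lambda>i. if i \<in> M then b else c) [Suc 0..<Suc k]"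
      for b c :: "('r gen, 'k) free_algebra"
      by auto
    show ?thesis
      using card_insert_nonadj[OF that] by (simp add: T_member_def pw_def a_def mult.assoc[where 'a = "('r gen, 'k) free_algebra"] m del: upt_Suc)
  qed
  have "sum ?G (nonadj (Suc (Suc k))) = - ((?U + ?V) * ?l) + ?U * ?l'"
    unfolding sum_nonadj_split(2)[of _ "Suc k"] sum_nonadj_split(1) nonadj_Suc_notin[of "Suc k"]
    unfolding unmarked_sum_def marked_sum_def sum_nonadj_split(2)[symmetric]
    by (simp add: 1 2 sum_negf sum_distrib_right)
  moreover have "nonadj (Suc (Suc k)) = insert {} (T_index (Suc (Suc k)))" "{} \<notin> T_index (Suc (Suc k))"
    by (auto simp: nonadj_def T_index_def)
  moreover have "finite (T_index (Suc (Suc k)))"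
    by (rule finite_subset[OF _ finite_nonadj[of "Suc (Suc k)"]]) (auto simp: nonadj_def T_index_def)
  moreover have "?G {} = - (a * letter Q ^ k * ?l)"
    by (simp add: T_member_def a_def mult.assoc map_replicate_const prod_list_replicate del: upt_Suc)
  ultimately show ?thesis
    unfolding T_sum_def by (simp add: algebra_simps)
qed


section \<open>Soundness of the reductions\<close>

lemma quot_map_add: "quot_map R f = quot_map R f' \<Longrightarrow> quot_map R g = quot_map R g' \<Longrightarrow>
    quot_map R (f + g) = quot_map R (f' + g')"
  unfolding quot_map_eq_iff by (drule (1) rel_ideal_closed(2)) (simp add: algebra_simps)

lemma quot_map_diff: "quot_map R f = quot_map R f' \<Longrightarrow> quot_map R g = quot_map R g' \<Longrightarrow>
    quot_map R (f - g) = quot_map R (f' - g')"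
  unfolding quot_map_eq_iff by (drule (1) rel_ideal_closed(4)) (simp add: algebra_simps)

lemma quot_map_scale: "quot_map R f = quot_map R f' \<Longrightarrow> quot_map R (fscale c f) = quot_map R (fscale c f')"
  unfolding quot_map_eq_iff by (drule rel_ideal_closed(7)[of _ _ c]) (simp add: fa.scale_right_diff_distrib)

lemma quot_map_mult:
  assumes "quot_map R f = quot_map R f'" "quot_map R g = quot_map R g'"
  shows "quot_map R (f * g) = quot_map R (f' * g')"
proof -
  have "(f - f') * g + f' * (g - g') \<in> rel_ideal R"
    using assms unfolding quot_map_eq_iff by (intro rel_ideal_closed(2,5,6))
  then show ?thesis unfolding quot_map_eq_iff by (simp add: algebra_simps)
qed

lemma quot_map_sum: "(\<And>i. i \<in> I \<Longrightarrow> quot_map R (f i) = quot_map R (g i)) \<Longrightarrow>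
    quot_map R (sum f I) = quot_map R (sum g I)"
proof (induction I rule: infinite_finite_induct)
  case (insert x F)
  then have "quot_map R (f x) = quot_map R (g x)" "quot_map R (sum f F) = quot_map R (sum g F)"
    by blast+
  then show ?case unfolding sum.insert[OF insert(1,2)] by (rule quot_map_add)
qed simp_all

context inner_inverse_bases
begin

abbreviation "\<pi> \<equiv> quot_map rels"
abbreviation "nf \<equiv> nf_R scale C"

lemma pi_letter:
  "\<pi> (letter (Elt (x + y))) = \<pi> (letter (Elt x) + letter (Elt y))"
  "\<pi> (letter (Elt (scale c x))) = \<pi> (fscale c (letter (Elt x)))"
  "\<pi> (letter (Elt (x * y))) = \<pi> (letter (Elt x) * letter (Elt y))"
  "\<pi> (letter (Elt 1)) = \<pi> 1"
  "\<pi> (letter (Elt p) * letter Q * letter (Elt p)) = \<pi> (letter (Elt p))"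
  unfolding quot_map_eq_iff by (rule rel_ideal_closed(8), simp only: inner_inverse_rels_def Un_iff mem_Collect_eq, blast)+

lemma pi_letter_sum: "\<pi> (letter (Elt (sum f I))) = \<pi> (\<Sum>i\<in>I. letter (Elt (f i)))"
proof (induction I rule: infinite_finite_induct)
  case (insert x F)
  then show ?case using quot_map_add[OF refl insert(3)] pi_letter(1) by simp
qed (use pi_letter(2)[of 0 0] in simp_all)

lemma nf_expand:
  obtains c where "Poly_Mapping.keys c \<subseteq> C" "lin_comb scale c = r"
    "nf r = (\<Sum>b\<in>Poly_Mapping.keys c. fscale (Poly_Mapping.lookup c b) (if b = 1 then 1 else letter (Elt b)))"
proof -
  have "r \<in> span C" using C_basis(2) by simp
  then obtain c where c: "Poly_Mapping.keys c \<subseteq> C" "lin_comb scale c = r"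
    unfolding span_eq_lin_comb by blast
  have "(THE c. Poly_Mapping.keys c \<subseteq> C \<and> lin_comb scale c = r) = c"
  proof (rule the_equality)
    fix d assume d: "Poly_Mapping.keys d \<subseteq> C \<and> lin_comb scale d = r"
    have "Poly_Mapping.keys (d - c) \<subseteq> C"
      using c(1) d Poly_Mapping.keys_add[of d "- c"] by (simp add: keys_minus) blast
    then have "d - c = 0"
      using c d independent_iff_lin_comb[THEN iffD1, rule_format, OF C_basis(1), of "d - c"]
      by (simp add: lin_comb_diff)
    then show "d = c" by simp
  qed (use c in simp)
  then show ?thesis using that[OF c] by (simp add: nf_R_def Let_def)
qed

lemma pi_nf: "\<pi> (nf r) = \<pi> (letter (Elt r))"
proof -
  obtain c where c: "Poly_Mapping.keys c \<subseteq> C" "lin_comb scale c = r"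
    "nf r = (\<Sum>b\<in>Poly_Mapping.keys c. fscale (Poly_Mapping.lookup c b) (if b = 1 then 1 else letter (Elt b)))"
    by (rule nf_expand)
  have "\<pi> (nf r) = \<pi> (\<Sum>b\<in>Poly_Mapping.keys c. letter (Elt (scale (Poly_Mapping.lookup c b) b)))"
    unfolding c(3) by (rule quot_map_sum) (auto simp: pi_letter(2) intro!: quot_map_scale pi_letter(4)[symmetric])
  also have "\<dots> = \<pi> (letter (Elt r))"
    unfolding pi_letter_sum[symmetric] using c(2) by (simp add: lin_comb_def)
  finally show ?thesis .
qed

lemma nf_range: "nf r \<in> span_words (insert [] ((\<lambda>b. [Elt b]) ` (Bas - {p * s})))"
proof -
  obtain c where c: "Poly_Mapping.keys c \<subseteq> C" "lin_comb scale c = r"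
    "nf r = (\<Sum>b\<in>Poly_Mapping.keys c. fscale (Poly_Mapping.lookup c b) (if b = 1 then 1 else letter (Elt b)))"
    by (rule nf_expand)
  show ?thesis
    unfolding c(3) using c(1)
    by (intro span_words_sum span_words_scale) (auto simp flip: word_Nil)
qed

lemma pi_pqp: "\<pi> (letter (Elt (x * p)) * (letter Q * letter (Elt (p * y)))) = \<pi> (letter (Elt (x * p * y)))"
proof -
  have "\<pi> (letter (Elt (x * p)) * (letter Q * letter (Elt (p * y)))) =
      \<pi> (letter (Elt x) * letter (Elt p) * (letter Q * (letter (Elt p) * letter (Elt y))))"
    by (intro quot_map_mult pi_letter refl)
  also have "\<dots> = \<pi> (letter (Elt x) * (letter (Elt p) * letter Q * letter (Elt p)) * letter (Elt y))"
    by (simp add: mult.assoc)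
  also have "\<dots> = \<pi> (letter (Elt x) * letter (Elt p) * letter (Elt y))"
    by (intro quot_map_mult pi_letter refl)
  also have "\<dots> = \<pi> (letter (Elt (x * p)) * letter (Elt y))"
    by (intro quot_map_mult pi_letter(3)[symmetric] refl)
  finally show ?thesis by (simp add: pi_letter)
qed

lemma pi_one_minus_ps: "\<pi> (1 - letter (Elt (p * s))) = \<pi> (letter (Elt (t * p)))"
proof -
  have "\<pi> (1 - letter (Elt (p * s))) = \<pi> (letter (Elt (p * s)) + letter (Elt (t * p)) - letter (Elt (p * s)))"
    using pi_letter(4) pi_letter(1)[of "p * s" "t * p"] by (intro quot_map_diff refl) (simp flip: one_eq)
  then show ?thesis by simp
qed

lemma pi_T_sum:
  "\<pi> (T_sum nf p s t x (Suc (Suc k)) y) =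
    \<pi> (letter (Elt (x * p)) * letter Q ^ Suc (Suc k) * letter (Elt (p * y)))"
proof -
  let ?f = "letter (Elt (p * s)) :: ('r gen, 'k) free_algebra"
  let ?l = "letter Q * letter (Elt (p * y)) :: ('r gen, 'k) free_algebra"
  let ?a = "letter (Elt (x * p)) * letter Q :: ('r gen, 'k) free_algebra"
  \<comment> \<open>As 1 - ps = tp, this is the relation tp q py = tpy. It serves twice: with
    \<open>s\<close> in place of \<open>y\<close> for the inner marks, and with the given
    \<open>y\<close> for the last one.\<close>
  have tail: "(1 - ?f) * (letter Q * letter (Elt (p * y))) - nf (t * p * y) \<in> rel_ideal rels" for y
    unfolding quot_map_eq_iff[symmetric] pi_nf pi_pqp[symmetric]
    by (intro quot_map_mult pi_one_minus_ps refl)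
  have "?a * ?f - nf (x * p * s) \<in> rel_ideal rels"
    unfolding quot_map_eq_iff[symmetric] pi_nf pi_pqp[symmetric] by (simp add: mult.assoc)
  note in_ideal = total_in_rel_ideal[OF this tail[of s, folded mult.assoc] tail[of y], where k = k]
  have "T_sum nf p s t x (Suc (Suc k)) y - ?a * letter Q ^ k * ?l \<in> rel_ideal rels"
    unfolding T_sum_eq using rel_ideal_closed(3)[OF in_ideal] by simp
  moreover have "?a * letter Q ^ k * ?l = letter (Elt (x * p)) * letter Q ^ Suc (Suc k) * letter (Elt (p * y))"
    by (simp add: mult.assoc power_commutes flip: power_Suc2)
      (simp add: mult.assoc flip: power_Suc2 mult.assoc)
  ultimately show ?thesis unfolding quot_map_eq_iff by simp
qed

end

section \<open>Termination of reductions\<close>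

lemma word_context_range:
  "word u * f * word v \<in> span_words {u @ w @ v | w. w \<in> Poly_Mapping.keys f}"
proof -
  have "word u * f \<in> span_words {u @ w | w. w \<in> Poly_Mapping.keys f}"
    by (rule span_words_mult[of _ "{u}" _ "Poly_Mapping.keys f"]) (auto simp: span_words_def[of "Poly_Mapping.keys f"])
  then show ?thesis
    by (rule span_words_mult[of _ _ _ "{v}"]) auto
qed

text \<open>A step removes the chosen word with its whole coefficient and introduces only smaller
  words, so the set of occurring words, viewed as a multiset, descends in the multiset extension of
  \<open>r\<close>. Cancellation among the other words only removes more.\<close>

lemma reduction_step_mult:
  assumes smaller: "\<And>W f w. (W, f) \<in> Rs \<Longrightarrow> w \<in> Poly_Mapping.keys f \<Longrightarrow> (w, W) \<in> r"
    and closed: "\<And>u v w W. (w, W) \<in> r \<Longrightarrow> (u @ w @ v, u @ W @ v) \<in> r" and wf: "wf r"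
    and step: "reduction_step Rs a a'"
  shows "(mset_set (Poly_Mapping.keys a'), mset_set (Poly_Mapping.keys a)) \<in> mult r"
proof -
  obtain W f u v where R: "(W, f) \<in> Rs" "u @ W @ v \<in> Poly_Mapping.keys a"
    "a' = a + fscale (Poly_Mapping.lookup a (u @ W @ v)) (word u * f * word v - word (u @ W @ v))"
    using step unfolding reduction_step_def by blast
  let ?z = "u @ W @ v" and ?g = "word u * f * word v"
  have g: "(w, ?z) \<in> r" if "w \<in> Poly_Mapping.keys ?g" for w
    using that word_context_range[of u f v] smaller[OF R(1)] closed unfolding span_words_def by blast
  \<comment> \<open>The replaced word cannot return through the new terms, since a well-founded
    relation is irreflexive; hence its coefficient is now exactly 0.\<close>
  then have "?z \<notin> Poly_Mapping.keys ?g" using wf by (meson wf_not_refl)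
  then have z: "?z \<notin> Poly_Mapping.keys a'"
    by (simp add: R(3) in_keys_iff lookup_add lookup_minus lookup_word)
  have k: "w \<in> Poly_Mapping.keys ?g" if "w \<in> Poly_Mapping.keys a' - Poly_Mapping.keys a" for w
    using that R(2) by (auto simp: R(3) in_keys_iff lookup_add lookup_minus lookup_word split: if_splits)
  let ?I = "Poly_Mapping.keys a \<inter> Poly_Mapping.keys a'"
  let ?J = "Poly_Mapping.keys a - Poly_Mapping.keys a'" and ?K = "Poly_Mapping.keys a' - Poly_Mapping.keys a"
  have "mset_set (Poly_Mapping.keys a) = mset_set ?I + mset_set ?J"
    by (subst mset_set_Union[symmetric]) (auto intro: arg_cong[where f = mset_set])
  moreover have "mset_set (Poly_Mapping.keys a') = mset_set ?I + mset_set ?K"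
    by (subst mset_set_Union[symmetric]) (auto intro: arg_cong[where f = mset_set])
  moreover have "(mset_set ?I + mset_set ?K, mset_set ?I + mset_set ?J) \<in> mult r"
  proof (rule one_step_implies_mult)
    have "?z \<in> ?J" using R(2) z by blast
    then show "mset_set ?J \<noteq> {#}" by (metis empty_iff finite_Diff finite_keys mset_set_empty_iff)
    show "\<forall>w\<in>set_mset (mset_set ?K). \<exists>j\<in>set_mset (mset_set ?J). (w, j) \<in> r"
      using \<open>?z \<in> ?J\<close> g k by auto
  qed
  ultimately show ?thesis by simp
qed

lemma wf_reduction_step:
  assumes "\<And>W f w. (W, f) \<in> Rs \<Longrightarrow> w \<in> Poly_Mapping.keys f \<Longrightarrow> (w, W) \<in> r"
    and "\<And>u v w W. (w, W) \<in> r \<Longrightarrow> (u @ w @ v, u @ W @ v) \<in> r" and "wf r"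
  shows "wf {(a', a). reduction_step Rs a a'}"
  by (rule wf_subset[OF wf_inv_image[OF wf_mult[OF assms(3)], of "\<lambda>a. mset_set (Poly_Mapping.keys a)"]])
     (use reduction_step_mult[OF assms] in auto)

lemma reduction_step_sound:
  assumes "\<And>W f. (W, f) \<in> Rs \<Longrightarrow> quot_map Rel (word W) = quot_map Rel f" "reduction_step Rs a a'"
  shows "quot_map Rel a' = quot_map Rel a"
proof -
  obtain W f u v where R: "(W, f) \<in> Rs"
    "a' = a + fscale (Poly_Mapping.lookup a (u @ W @ v)) (word u * f * word v - word (u @ W @ v))"
    using assms(2) unfolding reduction_step_def by blast
  have "quot_map Rel (word u * word W * word v) = quot_map Rel (word u * f * word v)"
    by (intro quot_map_mult refl assms(1)[OF R(1)])
  then have "word u * f * word v - word (u @ W @ v) \<in> rel_ideal Rel"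
    by (subst quot_map_eq_iff[symmetric]) (simp add: word_append mult.assoc)
  then show ?thesis unfolding quot_map_eq_iff R(2) by (simp add: rel_ideal_closed(7))
qed

lemma reduction_step_lists:
  assumes "\<And>W f. (W, f) \<in> Rs \<Longrightarrow> f \<in> span_words (lists G)" "reduction_step Rs a a'" "a \<in> span_words (lists G)"
  shows "a' \<in> span_words (lists G)"
proof -
  obtain W f u v where R: "(W, f) \<in> Rs" "u @ W @ v \<in> Poly_Mapping.keys a"
    "a' = a + fscale (Poly_Mapping.lookup a (u @ W @ v)) (word u * f * word v - word (u @ W @ v))"
    using assms(2) unfolding reduction_step_def by blast
  have z: "u @ W @ v \<in> lists G" using R(2) assms(3) unfolding span_words_def by blast
  have "{u @ w @ v | w. w \<in> Poly_Mapping.keys f} \<subseteq> lists G"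
  proof
    fix x assume "x \<in> {u @ w @ v | w. w \<in> Poly_Mapping.keys f}"
    then obtain w where "x = u @ w @ v" "w \<in> Poly_Mapping.keys f" by blast
    moreover from this have "w \<in> lists G" using assms(1)[OF R(1)] unfolding span_words_def by blast
    ultimately show "x \<in> lists G" using z by simp
  qed
  then have "word u * f * word v \<in> span_words (lists G)"
    using word_context_range span_words_mono by blast
  then show ?thesis
    unfolding R(3) using z assms(3) by (intro span_words_add span_words_scale span_words_diff) auto
qed

section \<open>The concrete reductions and their left-hand sides\<close>

lemma inner_inverse_reductionsI:
  fixes nf :: "'r::ring_1 \<Rightarrow> ('r gen, 'k::field) free_algebra" and p s t x y :: 'r and B Bxp Bpy :: "'r set"
  defines "Rs \<equiv> inner_inverse_reductions nf p s t B Bxp Bpy"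
  shows "x \<in> B \<Longrightarrow> y \<in> B \<Longrightarrow> ([Elt x, Elt y], nf (x * y)) \<in> Rs"
    and "([Elt (p * s)], 1 - letter (Elt (t * p))) \<in> Rs"
    and "x * p \<in> Bxp \<Longrightarrow> p * y \<in> Bpy \<Longrightarrow> ([Elt (x * p), Q, Elt (p * y)], nf (x * p * y)) \<in> Rs"
    and "x * p \<in> Bxp \<Longrightarrow> p * y \<in> Bpy \<Longrightarrow> n \<ge> 2 \<Longrightarrow>
      ([Elt (x * p)] @ replicate n Q @ [Elt (p * y)], T_sum nf p s t x n y) \<in> Rs"
    and "x * p \<in> Bxp \<Longrightarrow> ([Elt (x * p), Q, Elt (t * p)], word [Elt (x * p), Q] - nf (x * p * s)) \<in> Rs"
    and "x * p \<in> Bxp \<Longrightarrow> n \<ge> 2 \<Longrightarrow> ([Elt (x * p)] @ replicate n Q @ [Elt (t * p)],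
      word ([Elt (x * p)] @ replicate n Q) - T_sum nf p s t x n s) \<in> Rs"
  unfolding Rs_def inner_inverse_reductions_def by blast+

lemma forbidden_reducible:
  fixes nf :: "'r::ring_1 \<Rightarrow> ('r gen, 'k::field) free_algebra"
  assumes W: "W \<in> forbidden_words p s t B Bxp Bpy"
    and left: "\<And>u. u \<in> Bxp \<Longrightarrow> \<exists>x. u = x * p" and right: "\<And>u. u \<in> Bpy \<Longrightarrow> \<exists>y. u = p * y"
  shows "\<exists>f. (W, f) \<in> inner_inverse_reductions nf p s t B Bxp Bpy"
proof -
  note I = inner_inverse_reductionsI[where nf = nf and p = p and s = s and t = t and B = B and Bxp = Bxp and Bpy = Bpy]
  consider x y where "x \<in> B" "y \<in> B" "W = [Elt x, Elt y]"
    | "W = [Elt (p * s)]"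
    | u n w where "u \<in> Bxp" "w \<in> Bpy" "n \<ge> 1" "W = [Elt u] @ replicate n Q @ [Elt w]"
    | u n where "u \<in> Bxp" "n \<ge> 1" "W = [Elt u] @ replicate n Q @ [Elt (t * p)]"
    using W unfolding forbidden_words_def by blast
  then show ?thesis
  proof cases
    case 1
    then show ?thesis using I(1) by blast
  next
    case 2
    then show ?thesis using I(2) by blast
  next
    case (3 u n w)
    then obtain x y where xy: "u = x * p" "w = p * y" using left right by blast
    show ?thesis
    proof (cases "n = 1")
      case True
      then have "W = [Elt (x * p), Q, Elt (p * y)]" using 3 xy by simp
      then show ?thesis using I(3)[of x y] 3 xy by blast
    next
      case False
      then show ?thesis using I(4)[of x y n] 3 xy by auto
    qed
  next
    case (4 u n)
    then obtain x where x: "u = x * p" using left by blast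
    show ?thesis
    proof (cases "n = 1")
      case True
      then have "W = [Elt (x * p), Q, Elt (t * p)]" using 4 x by simp
      then show ?thesis using I(5)[of x] 4 x by blast
    next
      case False
      then show ?thesis using I(6)[of x n] 4 x by auto
    qed
  qed
qed

lemma inner_inverse_reductions_cases:
  fixes nf :: "'r::ring_1 \<Rightarrow> ('r gen, 'k::field) free_algebra"
  assumes "(W, f) \<in> inner_inverse_reductions nf p s t B Bxp Bpy"
  obtains (mult) x y where "x \<in> B" "y \<in> B" "W = [Elt x, Elt y]" "f = nf (x * y)"
  | (ps) "W = [Elt (p * s)]" "f = 1 - letter (Elt (t * p))"
  | (q1) x y where "x * p \<in> Bxp" "p * y \<in> Bpy" "W = [Elt (x * p), Q, Elt (p * y)]" "f = nf (x * p * y)"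
  | (q2) x k y where "x * p \<in> Bxp" "p * y \<in> Bpy" "W = [Elt (x * p)] @ replicate (Suc (Suc k)) Q @ [Elt (p * y)]"
      "f = T_sum nf p s t x (Suc (Suc k)) y"
  | (tp1) x where "x * p \<in> Bxp" "W = [Elt (x * p), Q, Elt (t * p)]" "f = word [Elt (x * p), Q] - nf (x * p * s)"
  | (tp2) x k where "x * p \<in> Bxp" "W = [Elt (x * p)] @ replicate (Suc (Suc k)) Q @ [Elt (t * p)]"
      "f = word ([Elt (x * p)] @ replicate (Suc (Suc k)) Q) - T_sum nf p s t x (Suc (Suc k)) s"
proof -
  have two: "\<exists>k. n = Suc (Suc k)" if "n \<ge> 2" for n :: nat using that by presburger
  consider x y where "x \<in> B" "y \<in> B" "W = [Elt x, Elt y]" "f = nf (x * y)"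
  | "W = [Elt (p * s)]" "f = 1 - letter (Elt (t * p))"
  | x y where "x * p \<in> Bxp" "p * y \<in> Bpy" "W = [Elt (x * p), Q, Elt (p * y)]" "f = nf (x * p * y)"
  | x n y where "x * p \<in> Bxp" "p * y \<in> Bpy" "W = [Elt (x * p)] @ replicate n Q @ [Elt (p * y)]"
      "f = T_sum nf p s t x n y" "n \<ge> 2"
  | x where "x * p \<in> Bxp" "W = [Elt (x * p), Q, Elt (t * p)]" "f = word [Elt (x * p), Q] - nf (x * p * s)"
  | x n where "x * p \<in> Bxp" "W = [Elt (x * p)] @ replicate n Q @ [Elt (t * p)]"
      "f = word ([Elt (x * p)] @ replicate n Q) - T_sum nf p s t x n s" "n \<ge> 2"
    using assms unfolding inner_inverse_reductions_def by blast
  then show ?thesis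
  proof cases
    case 1 then show ?thesis by (rule mult)
  next
    case 2 then show ?thesis by (rule ps)
  next
    case 3 then show ?thesis by (rule q1)
  next
    case (4 x n y)
    then obtain k where "n = Suc (Suc k)" using two by blast
    then show ?thesis using 4 q2 by blast
  next
    case 5 then show ?thesis by (rule tp1)
  next
    case (6 x n)
    then obtain k where "n = Suc (Suc k)" using two by blast
    then show ?thesis using 6 tp2 by blast
  qed
qed

context inner_inverse_bases
begin

section \<open>Soundness and descent of the concrete reductions\<close>

abbreviation "rules \<equiv> inner_inverse_reductions nf p s t Bas Bxp Bpy"
abbreviation "gens \<equiv> Elt ` Bas \<union> {Q}"

text \<open>Reduction (1) shortens the word without adding q; (3) and the subtracted part of (4)
  lose a q; the leading term of (4) keeps the number of q but drops the letter tp. In (2) the term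
  tp changes neither of these two counts, so the letters ps are counted as well.\<close>

definition word_less :: "('r gen list \<times> 'r gen list) set"
  where "word_less = inv_image (less_than <*lex*> less_than <*lex*> less_than)
    (\<lambda>w. (count_list w Q, length w, count_list w (Elt (p * s))))"

lemma wf_word_less: "wf word_less"
  unfolding word_less_def by (intro wf_inv_image wf_lex_prod wf_less_than)

lemma word_less_context: "(w, W) \<in> word_less \<Longrightarrow> (u @ w @ v, u @ W @ v) \<in> word_less"
  by (auto simp: word_less_def)

definition deg_le :: "nat \<Rightarrow> 'r gen list set"
  where "deg_le j = {w \<in> lists gens. count_list w Q \<le> j}"

lemma deg_le_mult: "f \<in> span_words (deg_le i) \<Longrightarrow> g \<in> span_words (deg_le j) \<Longrightarrow> f * g \<in> span_words (deg_le (i + j))"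
  by (erule (1) span_words_mult) (auto simp: deg_le_def)

lemma nf_deg: "nf r \<in> span_words (deg_le 0)"
  by (rule span_words_mono[OF nf_range]) (auto simp: deg_le_def)

lemma letter_deg: "letter Q \<in> span_words (deg_le 1)" "b \<in> Bas \<Longrightarrow> letter (Elt b) \<in> span_words (deg_le 0)"
  by (auto simp: deg_le_def)

lemma prod_list_deg:
  "(\<Prod>i\<leftarrow>xs. if i \<in> M then nf r else letter Q) \<in> span_words (deg_le (length (filter (\<lambda>i. i \<notin> M) xs)))"
proof (induction xs)
  case Nil
  show ?case by (simp add: deg_le_def flip: word_Nil)
next
  case (Cons x xs)
  then show ?case
    using deg_le_mult[OF nf_deg Cons.IH] deg_le_mult[OF letter_deg(1) Cons.IH] by simp
qed

lemma T_sum_deg: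
  assumes "x * p \<in> Bas" "p * y \<in> Bas"
  shows "T_sum nf p s t x (Suc (Suc k)) y \<in> span_words (deg_le (Suc k))"
  unfolding T_sum_def
proof (rule span_words_sum)
  fix M assume M: "M \<in> T_index (Suc (Suc k))"
  let ?a = "(if 0 \<in> M then 0 else 1) :: nat" and ?b = "length (filter (\<lambda>i. i \<notin> M) [1..<Suc k])"
    and ?c = "(if Suc k \<in> M then 0 else 1) :: nat"
  let ?f = "(if 0 \<in> M then nf (x * p * s) else letter (Elt (x * p)) * letter Q) *
     (\<Prod>i\<leftarrow>[1..<Suc k]. if i \<in> M then nf (t * p * s) else letter Q) *
     (if Suc k \<in> M then nf (t * p * y) else letter Q * letter (Elt (p * y)))"
  have "?f \<in> span_words (deg_le (?a + ?b + ?c))"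
    using deg_le_mult[OF letter_deg(2)[OF assms(1)] letter_deg(1)]
      deg_le_mult[OF letter_deg(1) letter_deg(2)[OF assms(2)]]
    by (intro deg_le_mult prod_list_deg) (auto simp: nf_deg)
  \<comment> \<open>A marking in T is nonempty, so at least one of the k + 2 letters q has been
    replaced by an element of \<open>R\<close>.\<close>
  moreover have "?a + ?b + ?c \<le> Suc k"
  proof -
    obtain i where i: "i \<in> M" "i < Suc (Suc k)" using M by (auto simp: T_index_def)
    have le: "?b \<le> k" using length_filter_le[of "\<lambda>i. i \<notin> M" "[1..<Suc k]"] by (simp del: upt_Suc)
    consider "i = 0" | "i = Suc k" | "i \<in> set [1..<Suc k]" using i by force
    then show ?thesis
    proof cases
      case 3
      then have "?b < length [1..<Suc k]" by (rule length_filter_less) (use i in simp)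
      then show ?thesis by (simp del: upt_Suc)
    qed (use i le in \<open>auto simp del: upt_Suc\<close>)
  qed
  ultimately have "?f \<in> span_words (deg_le (Suc k))"
    by (elim span_words_mono) (auto simp: deg_le_def)
  then show "T_member nf p s t x (Suc (Suc k)) y M \<in> span_words (deg_le (Suc k))"
    by (simp add: T_member_def span_words_uminus del: upt_Suc)
qed

lemma deg_replicate: "deg (replicate n Q) = n"
  by (induction n) simp_all

lemma word_replicate: "word (replicate n (Q :: 'r gen)) = letter Q ^ n"
proof (induction n)
  case (Suc n)
  have "replicate (Suc n) Q = [Q :: 'r gen] @ replicate n Q" by simp
  then show ?case by (simp only: word_append Suc.IH power_Suc)
qed (simp add: word_Nil)

lemma word_Cons: "w \<noteq> [] \<Longrightarrow> word (g # w) = letter g * word w"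
  using word_append[of "[g]" w] by simp

lemma rules_sound:
  assumes "(W, f) \<in> rules"
  shows "\<pi> (word W) = \<pi> f"
proof -
  have tp: "\<pi> (letter (Elt (t * p))) = \<pi> (1 - letter (Elt (p * s)))"
    using pi_one_minus_ps by simp
  have pow: "word ([Elt b] @ replicate n Q @ [g]) = letter (Elt b) * letter Q ^ n * letter g"
    for b :: 'r and n g
    by (simp only: word_append word_replicate mult.assoc)
  show ?thesis using assms
  proof (cases rule: inner_inverse_reductions_cases)
    case (mult x y)
    then show ?thesis using pi_letter(3)[of x y] by (simp add: word_Cons pi_nf)
  next
    case ps
    have "\<pi> (1 - (1 - letter (Elt (p * s)))) = \<pi> (1 - letter (Elt (t * p)))"
      by (intro quot_map_diff refl pi_one_minus_ps)
    then show ?thesis using ps by simp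
  next
    case (q1 x y)
    then show ?thesis using pi_pqp[of x y] by (simp add: word_Cons pi_nf)
  next
    case (q2 x k y)
    then show ?thesis using pi_T_sum[of x k y] by (simp only: pow)
  next
    case (tp1 x)
    \<comment> \<open>Reduction (4) is reduction (3) for \<open>y = s\<close>, after substituting tp
      = 1 - ps.\<close>
    let ?u = "letter (Elt (x * p)) * letter Q :: ('r gen, 'k) free_algebra"
    have "\<pi> (?u * letter (Elt (t * p))) = \<pi> (?u * (1 - letter (Elt (p * s))))"
      by (intro quot_map_mult refl tp)
    also have "\<dots> = \<pi> (?u - letter (Elt (x * p)) * (letter Q * letter (Elt (p * s))))"
      by (simp add: algebra_simps)
    also have "\<dots> = \<pi> (?u - nf (x * p * s))"
      by (intro quot_map_diff refl) (simp add: pi_pqp pi_nf)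
    finally show ?thesis using tp1 by (simp add: word_Cons mult.assoc)
  next
    case (tp2 x k)
    let ?u = "letter (Elt (x * p)) * letter Q ^ Suc (Suc k) :: ('r gen, 'k) free_algebra"
    have "\<pi> (?u * letter (Elt (t * p))) = \<pi> (?u * (1 - letter (Elt (p * s))))"
      by (intro quot_map_mult refl tp)
    also have "\<dots> = \<pi> (?u - ?u * letter (Elt (p * s)))"
      by (simp add: right_diff_distrib)
    also have "\<dots> = \<pi> (?u - T_sum nf p s t x (Suc (Suc k)) s)"
      by (intro quot_map_diff refl pi_T_sum[symmetric])
    finally show ?thesis using tp2 by (simp only: word_append word_replicate mult.assoc)
  qed
qed

lemma rules_range:
  assumes "(W, f) \<in> rules"
  shows "f \<in> span_words {w \<in> lists gens. (w, W) \<in> word_less}"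
proof -
  let ?S = "span_words {w \<in> lists gens. (w, W) \<in> word_less}"
  have deg: "g \<in> ?S" if "g \<in> span_words (deg_le j)" "j < count_list W Q" for g j
    using that(1) by (rule span_words_mono) (use that(2) in \<open>auto simp: deg_le_def word_less_def\<close>)
  show ?thesis using assms
  proof (cases rule: inner_inverse_reductions_cases)
    case (mult x y)
    show ?thesis unfolding mult(4)
      by (rule span_words_mono[OF nf_range]) (auto simp: word_less_def mult)
  next
    case ps
    show ?thesis unfolding ps(2)
      by (rule span_words_diff) (use tp_Bmp ps_neq_tp in \<open>auto simp: word_less_def ps simp flip: word_Nil\<close>)
  next
    case (q1 x y)
    then show ?thesis using deg[OF nf_deg] by simp
  next
    case (q2 x k y)
    then have "x * p \<in> Bas" "p * y \<in> Bas" by blast+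
    then show ?thesis using q2 deg[OF T_sum_deg[of x y k]] by (simp add: count_list_append deg_replicate)
  next
    case (tp1 x)
    then have "[Elt (x * p), Q] \<in> lists gens" by auto
    moreover have "nf (x * p * s) \<in> ?S" using deg[OF nf_deg] tp1 by simp
    ultimately show ?thesis unfolding tp1(3)
      by (intro span_words_diff) (auto simp: word_less_def tp1)
  next
    case (tp2 x k)
    then have "x * p \<in> Bas" "p * s \<in> Bas" using ps_Bpm by blast+
    then have "T_sum nf p s t x (Suc (Suc k)) s \<in> ?S"
      using tp2 deg[OF T_sum_deg[of x s k]] by (simp add: count_list_append deg_replicate)
    moreover have "[Elt (x * p)] @ replicate (Suc (Suc k)) Q \<in> lists gens"
      using \<open>x * p \<in> Bas\<close> by auto
    ultimately show ?thesis unfolding tp2(3)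
      by (intro span_words_diff) (auto simp: word_less_def tp2 count_list_append deg_replicate)
  qed
qed

text \<open>The presentation has a letter for every element of \<open>R\<close>, whereas the
  reductions are applied to words in \<open>B\<close> and q. Replacing each letter by its
  \<open>nf\<close> bridges the two.\<close>

lemma letters_reduce: "\<exists>g\<in>span_words (lists gens). f - g \<in> rel_ideal rels"
proof -
  have *: "\<exists>g\<in>span_words (lists gens). \<pi> (word w) = \<pi> g" for w
  proof (induction w)
    case Nil
    show ?case by (intro bexI[of _ "word []"]) simp_all
  next
    case (Cons a w)
    then obtain g where g: "g \<in> span_words (lists gens)" "\<pi> (word w) = \<pi> g" by blast
    obtain h where h: "h \<in> span_words (lists gens)" "\<pi> (letter a) = \<pi> h"
    proof (cases a)
      case (Elt r)
      have "nf r \<in> span_words (lists gens)"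
        by (rule span_words_mono[OF nf_range]) auto
      then show ?thesis using that Elt pi_nf by simp
    next
      case Q
      then show ?thesis using that[of "letter Q"] by simp
    qed
    have "\<pi> (word ([a] @ w)) = \<pi> (h * g)"
      unfolding word_append by (intro quot_map_mult g h)
    moreover have "h * g \<in> span_words (lists gens)"
      using h(1) g(1) by (rule span_words_mult) auto
    ultimately show ?case by auto
  qed
  then obtain G where G: "\<And>w. G w \<in> span_words (lists gens)" "\<And>w. \<pi> (word w) = \<pi> (G w)" by metis
  have "\<pi> (lift word f) = \<pi> (lift G f)"
    unfolding lift_def by (intro quot_map_sum quot_map_scale G)
  moreover have "lift G f \<in> span_words (lists gens)"
    by (rule lift_in_span_words[of _ UNIV, OF _ G(1)]) (simp add: span_words_def)
  ultimately show ?thesis by (auto simp: lift_word_id quot_map_eq_iff)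
qed

section \<open>From irreducible elements to the unique normal form\<close>

lemma rules_terminate: "wf {(a', a). reduction_step rules a a'}"
  by (rule wf_reduction_step[OF _ word_less_context wf_word_less])
     (use rules_range in \<open>unfold span_words_def, blast\<close>)

lemma irreducible_normal:
  assumes "d \<in> span_words (lists gens)" "\<nexists>e. reduction_step rules d e"
  shows "d \<in> span_words (normal_words p s t Bas Bxp Bpy)"
proof -
  have "w \<in> normal_words p s t Bas Bxp Bpy" if w: "w \<in> Poly_Mapping.keys d" for w
  proof -
    have "\<not> sublist W w" if W: "W \<in> forbidden_words p s t Bas Bxp Bpy" for W
    proof
      assume "sublist W w"
      then obtain u v where "w = u @ W @ v" by (auto simp: sublist_def)
      moreover obtain f where "(W, f) \<in> rules"
      proof -
        have "\<exists>x. u = x * p" if "u \<in> Bxp" for u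
          using left_factor[OF that] by metis
        moreover have "\<exists>y. u = p * y" if "u \<in> Bpy" for u
          using that basis_pR(3) span_superset[of Bpy] unfolding right_ideal_of_def by blast
        ultimately show ?thesis using forbidden_reducible[OF W] that by blast
      qed
      ultimately show False using assms(2) w unfolding reduction_step_def by blast
    qed
    moreover have "w \<in> lists gens" using w assms(1) unfolding span_words_def by blast
    ultimately show ?thesis unfolding normal_words_def by blast
  qed
  then show ?thesis unfolding span_words_def by blast
qed

lemma reachable:
  assumes "(reduction_step rules)\<^sup>*\<^sup>* a d" "a \<in> span_words (lists gens)"
  shows "d \<in> span_words (lists gens) \<and> \<pi> d = \<pi> a"
  using assms(1)
proof induction
  case (step y z)
  have "f \<in> span_words (lists gens)" if "(W, f) \<in> rules" for W f
    by (rule span_words_mono[OF rules_range[OF that]]) blast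
  then show ?case
    using step reduction_step_lists[where Rs = rules and G = gens and a = y and a' = z]
      reduction_step_sound[OF rules_sound, where a = y and a' = z] by simp
qed (use assms(2) in simp)

text \<open>This also yields confluence: all irreducible results of one element have the same image
  in \<open>R'\<close>, and being combinations of normal words they coincide.\<close>

lemma normal_form_unique:
  assumes "f \<in> span_words (normal_words p s t Bas Bxp Bpy)" "g \<in> span_words (normal_words p s t Bas Bxp Bpy)"
    "\<pi> f = \<pi> g"
  shows "f = g"
proof -
  have "f - g \<in> span_words (normal_words p s t Bas Bxp Bpy)" "f - g \<in> rel_ideal rels"
    using assms by (auto simp: span_words_diff quot_map_eq_iff)
  then have "f - g = 0" unfolding normal_words_eq by (rule normal_independent)
  then show ?thesis by simp
qed

lemma normal_form_exists:
  assumes "a \<in> span_words (lists gens)"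
  obtains d where "(reduction_step rules)\<^sup>*\<^sup>* a d" "\<nexists>e. reduction_step rules d e"
proof -
  have "\<exists>d. (reduction_step rules)\<^sup>*\<^sup>* a d \<and> (\<nexists>e. reduction_step rules d e)"
    using rules_terminate
  proof (induction a rule: wf_induct_rule)
    case (less a)
    then show ?case by (cases "\<exists>e. reduction_step rules a e") (blast intro: converse_rtranclp_into_rtranclp)+
  qed
  then show ?thesis using that by blast
qed

lemma normal_words_basis:
  "words_give_basis (presented_algebra rels) \<pi> (normal_words p s t Bas Bxp Bpy)"
proof (rule words_give_basis_presented)
  fix f
  obtain g where g: "g \<in> span_words (lists gens)" "f - g \<in> rel_ideal rels"
    using letters_reduce by blast
  then obtain d where d: "(reduction_step rules)\<^sup>*\<^sup>* g d" "\<nexists>e. reduction_step rules d e"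
    using normal_form_exists by blast
  then have "d \<in> span_words (normal_words p s t Bas Bxp Bpy)" "\<pi> d = \<pi> g"
    using reachable g irreducible_normal by blast+
  moreover have "\<pi> f = \<pi> g" using g by (simp add: quot_map_eq_iff)
  ultimately show "\<exists>g\<in>span_words (normal_words p s t Bas Bxp Bpy). f - g \<in> rel_ideal rels"
    unfolding quot_map_eq_iff[symmetric] by metis
next
  show "f \<in> span_words (normal_words p s t Bas Bxp Bpy) \<Longrightarrow> f \<in> rel_ideal rels \<Longrightarrow> f = 0" for f
    unfolding normal_words_eq by (rule normal_independent)
qed

lemma rules_normal_form:
  "reduces_to_normal_form \<pi> gens (normal_words p s t Bas Bxp Bpy) rules"
  unfolding reduces_to_normal_form_def
proof (intro conjI ballI)
  show "case r of (w, f) \<Rightarrow> \<pi> (word w) = \<pi> f" if "r \<in> rules" for r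
    using rules_sound that by (cases r) blast
  fix a :: "('r gen, 'k) free_algebra" assume a: "a \<in> span_words (lists gens)"
  show "\<nexists>h. h 0 = a \<and> (\<forall>i. reduction_step rules (h i) (h (Suc i)))"
    using rules_terminate unfolding wf_iff_no_infinite_down_chain by blast
  obtain b where b: "(reduction_step rules)\<^sup>*\<^sup>* a b" "\<nexists>e. reduction_step rules b e"
    using normal_form_exists[OF a] by blast
  have nf: "d \<in> span_words (normal_words p s t Bas Bxp Bpy) \<and> \<pi> d = \<pi> a"
    if "(reduction_step rules)\<^sup>*\<^sup>* a d" "\<nexists>e. reduction_step rules d e" for d
    using reachable[OF that(1) a] irreducible_normal that(2) by blast
  show "\<exists>b. b \<in> span_words (normal_words p s t Bas Bxp Bpy) \<and> \<pi> b = \<pi> a \<and>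
      (\<forall>b'. b' \<in> span_words (normal_words p s t Bas Bxp Bpy) \<and> \<pi> b' = \<pi> a \<longrightarrow> b' = b) \<and>
      (\<forall>d. (reduction_step rules)\<^sup>*\<^sup>* a d \<and> (\<nexists>e. reduction_step rules d e) \<longrightarrow> d = b)"
    using nf[OF b] nf normal_form_unique by (intro exI[of _ b]) metis
qed

end

theorem theorem13:
  fixes scale :: "'k::field \<Rightarrow> 'r::ring_1 \<Rightarrow> 'r"
    and p s t :: 'r
    and Bpp Bpm Bmp Bmm B Bxp Bpy :: "'r set"
    and nf :: "'r \<Rightarrow> ('r gen, 'k) free_algebra"
  assumes "k_algebra scale"
    and "1 \<in> ideal_sum_of p"
    and "1 \<notin> right_ideal_of p"
    and "1 \<notin> left_ideal_of p"
    and "1 = p * s + t * p"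
    and "rel_basis scale {0} (right_ideal_of p \<inter> left_ideal_of p) Bpp"
    and "p \<in> Bpp"
    and "rel_basis scale (right_ideal_of p \<inter> left_ideal_of p) (right_ideal_of p) Bpm"
    and "p * s \<in> Bpm"
    and "rel_basis scale (right_ideal_of p \<inter> left_ideal_of p) (left_ideal_of p) Bmp"
    and "t * p \<in> Bmp"
    and "rel_basis scale (ideal_sum_of p) UNIV Bmm"
    and "B = Bpp \<union> Bpm \<union> Bmp \<union> Bmm"
    and "Bxp = Bpp \<union> Bmp"
    and "Bpy = Bpp \<union> Bpm"
    and "nf = nf_R scale ((B \<union> {1}) - {p * s})"
  shows "words_give_basis
           (presented_algebra (inner_inverse_rels scale p))
           (quot_map (inner_inverse_rels scale p))
           (normal_words p s t B Bxp Bpy) \<and>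
         reduces_to_normal_form
           (quot_map (inner_inverse_rels scale p))
           (Elt ` B \<union> {Q})
           (normal_words p s t B Bxp Bpy)
           (inner_inverse_reductions nf p s t B Bxp Bpy)"
proof -
  interpret inner_inverse_bases scale p s t Bpp Bpm Bmp Bmm
    by (rule inner_inverse_bases.intro[OF assms(1) inner_inverse_bases_axioms.intro]) fact+
  \<comment> \<open>Adjoining \<open>1\<close> before or after removing \<open>p * s\<close> gives
    the same set only because the two elements differ.\<close>
  have "p * s \<noteq> 1" using one_notin_Bas ps_Bpm by auto
  then have "(B \<union> {1}) - {p * s} = C" unfolding assms(13) by blast
  then show ?thesis
    unfolding assms(13-16) using normal_words_basis rules_normal_form by simp
qed

end
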